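(* Let $u$ be an element of $F_2$, and let $\Omega$ be the set of all chains of type (C1) or (C2) of length less than or equal to $2\|u\|+3$. Suppose that the cyclic word $[\phi(u)]$ is positive for some automorphism $\phi$ of $F_2$. Then there exist $\psi \in \Omega$ and a Whitehead automorphism $\beta$ of $F_2$ of type (W1) such that the cyclic word $[\beta\psi(u)]$ is positive (equivalently, there exists $c \in F_2$ such that $\pi_c\beta\psi(u)$ is positive, where $\pi_c$ is the inner automorphism of $F_2$ induced by $c$).
   Context: $F_2$ is the free group with basis $\{a,b\}$; elements are identified with reduced words. For $v\in F_2$, $[v]$ denotes the cyclic word associated with $v$, i.e. the set of all cyclic permutations of a cyclically reduced word conjugate to $v$, and $\|v\|$ denotes the length of $[v]$, i.e. the length of a cyclically reduced word conjugate to $v$. A (cyclic) word is positive if it has no negative exponents (no occurrence of $a^{-1}$ or $b^{-1}$). Compositions act on the left: $\phi\psi(u)=\phi(\psi(u))$. A Whitehead automorphism of type (W1) is an automorphism of $F_2$ that permutes the elements of $\{a,b,a^{-1},b^{-1}\}$. Let $\sigma,\tau$ be the automorphisms of $F_2$ with $\sigma(a)=ab,\ \sigma(b)=b$ and $\tau(a)=a,\ \tau(b)=ba$. A chain of type (C1) is a composition $\tau^{m_k}\sigma^{l_k}\cdots\tau^{m_1}\sigma^{l_1}$, and a chain of type (C2) is a composition $\tau^{-m_k}\sigma^{-l_k}\cdots\tau^{-m_1}\sigma^{-l_1}$, with $k\in\mathbb{N}$ and all $l_i,m_i\ge 0$; the length of such a chain is $\sum_{i=1}^k(m_i+l_i)$.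 *)

theory Defs
  imports "HOL-Algebra.Group"
begin

datatype gen = GenA | GenB

text \<open>The letter \<open>(g, True)\<close> stands for the generator \<open>g\<close>, and \<open>(g, False)\<close> for its
  formal inverse.\<close>

type_synonym letter = "gen \<times> bool"
type_synonym word = "letter list"

definition letter_inv :: "letter \<Rightarrow> letter" where
  "letter_inv x = (fst x, \<not> snd x)"

definition reduced :: "word \<Rightarrow> bool" where
  "reduced w \<longleftrightarrow> successively (\<lambda>x y. y \<noteq> letter_inv x) w"

fun cancel_cons :: "letter \<Rightarrow> word \<Rightarrow> word" where
  "cancel_cons x [] = [x]"
| "cancel_cons x (y # w) = (if y = letter_inv x then w else x # y # w)"

definition reduce :: "word \<Rightarrow> word" where
  "reduce w = foldr cancel_cons w []"

definition F2 :: "word monoid" where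
  "F2 = \<lparr>carrier = {w. reduced w}, mult = (\<lambda>v w. reduce (v @ w)), one = []\<rparr>"

definition gen_a :: word where "gen_a = [(GenA, True)]"
definition gen_b :: word where "gen_b = [(GenB, True)]"

text \<open>The endomorphism of \<open>F2\<close> given by \<open>a \<mapsto> x\<close>, \<open>b \<mapsto> y\<close>.\<close>

definition letter_image :: "word \<Rightarrow> word \<Rightarrow> letter \<Rightarrow> word" where
  "letter_image x y l =
     (let z = (case fst l of GenA \<Rightarrow> x | GenB \<Rightarrow> y) in if snd l then z else inv\<^bsub>F2\<^esub> z)"

definition F2_endo :: "word \<Rightarrow> word \<Rightarrow> word \<Rightarrow> word" where
  "F2_endo x y w = foldr (\<lambda>l r. letter_image x y l \<otimes>\<^bsub>F2\<^esub> r) w \<one>\<^bsub>F2\<^esub>"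

definition inner :: "word \<Rightarrow> word \<Rightarrow> word" where
  "inner c v = c \<otimes>\<^bsub>F2\<^esub> v \<otimes>\<^bsub>F2\<^esub> inv\<^bsub>F2\<^esub> c"

definition cyclically_reduced :: "word \<Rightarrow> bool" where
  "cyclically_reduced w \<longleftrightarrow> reduced w \<and> (w \<noteq> [] \<longrightarrow> hd w \<noteq> letter_inv (last w))"

text \<open>All cyclically reduced conjugates of \<open>v\<close> are cyclic permutations of each other, so
  collecting the permutations of all of them is the same as choosing one.\<close>

definition cyclic_word :: "word \<Rightarrow> word set" where
  "cyclic_word v =
     {rotate n w | n w. cyclically_reduced w \<and> (\<exists>c\<in>carrier F2. w = inner c v)}"

definition cyclic_length :: "word \<Rightarrow> nat" where
  "cyclic_length v = length (SOME w. w \<in> cyclic_word v)"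

definition positive :: "word \<Rightarrow> bool" where
  "positive w \<longleftrightarrow> (\<forall>l\<in>set w. snd l)"

definition positive_cyclic :: "word set \<Rightarrow> bool" where
  "positive_cyclic C \<longleftrightarrow> (\<forall>w\<in>C. positive w)"

definition Whitehead1 :: "(word \<Rightarrow> word) set" where
  "Whitehead1 = {\<beta> \<in> iso F2 F2.
     \<beta> ` {gen_a, gen_b, inv\<^bsub>F2\<^esub> gen_a, inv\<^bsub>F2\<^esub> gen_b} =
       {gen_a, gen_b, inv\<^bsub>F2\<^esub> gen_a, inv\<^bsub>F2\<^esub> gen_b}}"

definition sigma :: "word \<Rightarrow> word" where
  "sigma = F2_endo (gen_a \<otimes>\<^bsub>F2\<^esub> gen_b) gen_b"

definition tau :: "word \<Rightarrow> word" where
  "tau = F2_endo gen_a (gen_b \<otimes>\<^bsub>F2\<^esub> gen_a)"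

definition sigma_inv :: "word \<Rightarrow> word" where
  "sigma_inv = inv_into (carrier F2) sigma"

definition tau_inv :: "word \<Rightarrow> word" where
  "tau_inv = inv_into (carrier F2) tau"

text \<open>For \<open>es = [(l\<^sub>1, m\<^sub>1), \<dots>, (l\<^sub>k, m\<^sub>k)]\<close> this is the composition
  \<open>t\<^bsup>m\<^sub>k\<^esup> s\<^bsup>l\<^sub>k\<^esup> \<cdots> t\<^bsup>m\<^sub>1\<^esup> s\<^bsup>l\<^sub>1\<^esup>\<close>, with \<open>(l\<^sub>1, m\<^sub>1)\<close> applied first.\<close>

definition chain :: "(word \<Rightarrow> word) \<Rightarrow> (word \<Rightarrow> word) \<Rightarrow> (nat \<times> nat) list \<Rightarrow> word \<Rightarrow> word" where
  "chain s t es = fold (\<lambda>(l, m) f. (t ^^ m) \<circ> (s ^^ l) \<circ> f) es id"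

definition chain_length :: "(nat \<times> nat) list \<Rightarrow> nat" where
  "chain_length es = (\<Sum>(l, m)\<leftarrow>es. m + l)"

definition C1_chains :: "nat \<Rightarrow> (word \<Rightarrow> word) set" where
  "C1_chains N = {chain sigma tau es | es. chain_length es \<le> N}"

definition C2_chains :: "nat \<Rightarrow> (word \<Rightarrow> word) set" where
  "C2_chains N = {chain sigma_inv tau_inv es | es. chain_length es \<le> N}"

definition Omega :: "word \<Rightarrow> (word \<Rightarrow> word) set" where
  "Omega u = C1_chains (2 * cyclic_length u + 3) \<union> C2_chains (2 * cyclic_length u + 3)"

end

theory Submission
  imports Defs
begin

text \<open>
  Up to inner automorphisms every automorphism of \<open>F\<^sub>2\<close> is a signed permutation of the basis after a
  chain: Nielsen reduction writes it as a product of elementary moves, and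
  \<open>\<tau>\<sigma>\<^sup>-\<^sup>1\<close> equals a signed permutation times \<open>\<tau>\<^sup>-\<^sup>1\<close>, which removes mixed signs. Conjugating by
  \<open>b \<mapsto> b\<^sup>-\<^sup>1\<close> turns the inverse chains into the positive ones, so it suffices to
  shorten a chain in \<open>\<sigma>\<close> and \<open>\<tau>\<close> that makes a cyclic word positive or negative.

  Call a letter opposed if the syllable following its own has the opposite sign, and a syllable
  isolated if both neighbouring syllables have the opposite sign. Writing a cyclic word as a product
  of blocks \<open>b\<^sup>\<epsilon> a\<^sup>n\<close>, the map \<open>\<tau>\<close> only adds \<open>(\<epsilon> + \<epsilon>')/2\<close> to \<open>n\<close>, where \<open>\<epsilon>'\<close> belongs to the next block;
  symmetrically for \<open>\<sigma>\<close>. Hence neither map increases the number of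
  opposed letters or creates isolated syllables, and \<open>\<tau>\<close> strictly decreases that number if there is an isolated
  syllable in \<open>a\<close>. If there is none and some chain succeeds, then all letters \<open>a\<close> have
  the same sign, and a power of \<open>\<sigma>\<close> succeeds. So \<open>\<parallel>u\<parallel>\<close> steps are enough.
\<close>
section \<open>The free group as a type\<close>

abbreviation word_inv :: "word \<Rightarrow> word" where
  "word_inv w \<equiv> rev (map letter_inv w)"

lemma letter_inv_inv [simp]: "letter_inv (letter_inv x) = x"
  by (simp add: letter_inv_def)

lemma letter_inv_neq [simp]: "letter_inv x \<noteq> x" "x \<noteq> letter_inv x"
  by (metis letter_inv_def snd_conv)+

lemma letter_inv_eq_iff [simp]: "letter_inv x = letter_inv y \<longleftrightarrow> x = y"
  by (metis letter_inv_inv)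

lemma reduced_Nil [simp]: "reduced []"
  by (simp add: reduced_def)

lemma reduced_single [simp]: "reduced [x]"
  by (simp add: reduced_def)

lemma reduced_Cons: "reduced (x # w) \<longleftrightarrow> reduced w \<and> (w \<noteq> [] \<longrightarrow> hd w \<noteq> letter_inv x)"
  by (cases w) (auto simp: reduced_def)

lemma reduced_append:
  "reduced (v @ w) \<longleftrightarrow> reduced v \<and> reduced w \<and> (v \<noteq> [] \<longrightarrow> w \<noteq> [] \<longrightarrow> hd w \<noteq> letter_inv (last v))"
  by (auto simp: reduced_def successively_append_iff)

lemma reduced_word_inv [simp]: "reduced (word_inv w) \<longleftrightarrow> reduced w"
proof -
  have "(\<lambda>x y. x \<noteq> letter_inv y) = (\<lambda>x y. y \<noteq> letter_inv x)"
    by (intro ext) (metis letter_inv_inv)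
  then show ?thesis
    by (simp add: reduced_def successively_rev successively_map) (simp only:)
qed

lemma reduce_Nil [simp]: "reduce [] = []"
  by (simp add: reduce_def)

lemma reduce_Cons: "reduce (x # w) = cancel_cons x (reduce w)"
  by (simp add: reduce_def)

lemma reduce_append: "reduce (v @ w) = foldr cancel_cons v (reduce w)"
  by (simp add: reduce_def)

lemma reduced_cancel_cons: "reduced w \<Longrightarrow> reduced (cancel_cons x w)"
  by (cases w) (auto simp: reduced_Cons)

lemma reduced_reduce [simp]: "reduced (reduce w)"
  by (induction w) (auto simp: reduce_Cons reduced_cancel_cons)

lemma reduce_id: "reduced w \<Longrightarrow> reduce w = w"
proof (induction w)
  case (Cons x w)
  then show ?case by (cases w) (auto simp: reduce_Cons reduced_Cons)
qed simp

lemma cancel_cons_inverse: "reduced w \<Longrightarrow> cancel_cons x (cancel_cons (letter_inv x) w) = w"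
  by (cases w rule: list.exhaust; cases "tl w") (auto simp: reduced_Cons)

lemma reduced_foldr: "reduced r \<Longrightarrow> reduced (foldr cancel_cons w r)"
  by (induction w) (auto simp: reduced_cancel_cons)

text \<open>Prepending with cancellation is an action on reduced words in which inverse letters act
  inversely, so a word and its reduced form act alike. Associativity of the group law follows from
  this.\<close>

lemma foldr_cancel_cons_reduce:
  assumes "reduced r"
  shows "foldr cancel_cons (reduce w) r = foldr cancel_cons w r"
proof (induction w)
  case (Cons x w)
  show ?case
  proof (cases "reduce w")
    case Nil
    then show ?thesis using Cons by (simp add: reduce_Cons)
  next
    case (Cons y v)
    have "foldr cancel_cons v r = cancel_cons x (cancel_cons (letter_inv x) (foldr cancel_cons v r))"
      using assms by (simp add: cancel_cons_inverse reduced_foldr)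
    then show ?thesis using Cons.IH \<open>reduce w = y # v\<close>
      by (auto simp: reduce_Cons)
  qed
qed simp

lemma reduce_append_reduce:
  "reduce (reduce v @ w) = reduce (v @ w)" "reduce (v @ reduce w) = reduce (v @ w)"
  by (simp_all add: reduce_append foldr_cancel_cons_reduce reduce_id)

lemma reduce_word_inv_append: "reduce (word_inv w @ w) = []"
proof -
  have "reduced r \<Longrightarrow> foldr cancel_cons (word_inv w) (foldr cancel_cons w r) = r" for r
  proof (induction w arbitrary: r)
    case (Cons x w)
    show ?case
      using Cons cancel_cons_inverse[of "foldr cancel_cons w r" "letter_inv x"]
      by (simp add: reduced_foldr)
  qed simp
  from this[of "[]"] show ?thesis by (simp add: reduce_append) (simp add: reduce_def)
qed

lemma length_reduce_le: "length (reduce w) \<le> length w"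
proof (induction w)
  case (Cons x w)
  then show ?case by (cases "reduce w") (auto simp: reduce_Cons)
qed simp

text \<open>A type instead of a carrier set makes the group laws unconditional rewrite rules,
  through the class \<open>group_add\<close>.\<close>

typedef free2 = "{w. reduced w}" morphisms nf Abs_free2
  by (rule exI[of _ "[]"]) simp

definition grp :: "word \<Rightarrow> free2" where
  "grp w = Abs_free2 (reduce w)"

lemma reduced_nf [simp]: "reduced (nf g)"
  using nf by simp

lemma nf_grp [simp]: "nf (grp w) = reduce w"
  by (simp add: grp_def Abs_free2_inverse)

lemma grp_nf [simp]: "grp (nf g) = g"
  by (simp add: grp_def reduce_id nf_inverse)

lemma grp_eq_iff: "grp v = grp w \<longleftrightarrow> reduce v = reduce w"
  by (metis nf_grp grp_def)

lemma grp_reduce [simp]: "grp (reduce w) = grp w"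
  by (simp add: grp_eq_iff reduce_id)

text \<open>The type class of not necessarily commutative groups is written additively.\<close>

instantiation free2 :: group_add
begin

definition zero_free2 :: free2 where "0 = grp []"
definition plus_free2 :: "free2 \<Rightarrow> free2 \<Rightarrow> free2" where "g + h = grp (nf g @ nf h)"
definition uminus_free2 :: "free2 \<Rightarrow> free2" where "- g = grp (word_inv (nf g))"
definition minus_free2 :: "free2 \<Rightarrow> free2 \<Rightarrow> free2" where "g - h = g + - (h :: free2)"

instance
proof
  fix g h k :: free2
  show "g + h + k = g + (h + k)"
    by (simp add: plus_free2_def grp_eq_iff reduce_append_reduce)
  show "0 + g = g" "g + 0 = g"
    by (simp_all add: plus_free2_def zero_free2_def)
  show "- g + g = 0"
    by (simp add: plus_free2_def zero_free2_def uminus_free2_def grp_eq_iff reduce_append_reduce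
        reduce_word_inv_append)
  show "g + - h = g - h"
    by (simp add: minus_free2_def)
qed

end

lemma grp_append: "grp (v @ w) = grp v + grp w"
  by (simp add: plus_free2_def grp_eq_iff reduce_append_reduce)

lemma grp_Nil [simp]: "grp [] = 0"
  by (simp add: zero_free2_def)

lemma grp_Cons: "grp (x # w) = grp [x] + grp w"
  using grp_append[of "[x]" w] by simp

lemma grp_letter_inv: "grp [letter_inv x] = - grp [x]"
  by (simp add: uminus_free2_def reduce_id)

lemma grp_word_inv: "grp (word_inv w) = - grp w"
proof (induction w)
  case (Cons x w)
  then show ?case by (simp add: grp_append grp_letter_inv grp_Cons[of x w] minus_add)
qed simp

lemma nf_uminus: "nf (- g) = word_inv (nf g)"
  by (simp add: uminus_free2_def reduce_id)

text \<open>Multiplies out to right-nested sums of signed terms. The default rule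
  \<open>add_uminus_conv_diff\<close> rewrites the other way and is therefore switched off alongside
  it.\<close>

lemmas group_add_norm = add.assoc minus_add diff_conv_add_uminus

definition genA :: free2 where "genA = grp [(GenA, True)]"
definition genB :: free2 where "genB = grp [(GenB, True)]"

definition additive :: "(free2 \<Rightarrow> free2) \<Rightarrow> bool" where
  "additive f \<longleftrightarrow> (\<forall>g h. f (g + h) = f g + f h)"

definition limg :: "free2 \<Rightarrow> free2 \<Rightarrow> letter \<Rightarrow> free2" where
  "limg x y l = (let z = (case fst l of GenA \<Rightarrow> x | GenB \<Rightarrow> y) in if snd l then z else - z)"

lemma limg_simps [simp]:
  "limg x y (GenA, True) = x" "limg x y (GenB, True) = y"
  "limg x y (GenA, False) = - x" "limg x y (GenB, False) = - y"
  by (simp_all add: limg_def)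

lemma limg_letter_inv: "limg x y (letter_inv l) = - limg x y l"
  by (simp add: limg_def letter_inv_def Let_def)

definition limgs :: "free2 \<Rightarrow> free2 \<Rightarrow> word \<Rightarrow> free2" where
  "limgs x y w = foldr (\<lambda>l r. limg x y l + r) w 0"

lemma limgs_Nil [simp]: "limgs x y [] = 0"
  and limgs_Cons [simp]: "limgs x y (l # w) = limg x y l + limgs x y w"
  by (simp_all add: limgs_def)

lemma limgs_append: "limgs x y (v @ w) = limgs x y v + limgs x y w"
  by (induction v) (simp_all add: add.assoc)

lemma limgs_reduce: "limgs x y (reduce w) = limgs x y w"
proof (induction w)
  case (Cons l w)
  have "limgs x y (cancel_cons l v) = limg x y l + limgs x y v" for v
    by (cases v) (simp_all add: limg_letter_inv group_add_norm del: add_uminus_conv_diff)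
  then show ?case by (simp add: reduce_Cons Cons.IH)
qed simp

definition sub :: "free2 \<Rightarrow> free2 \<Rightarrow> free2 \<Rightarrow> free2" where
  "sub x y g = limgs x y (nf g)"

lemma sub_grp: "sub x y (grp w) = limgs x y w"
  by (simp add: sub_def limgs_reduce)

lemma additive_sub: "additive (sub x y)"
  unfolding additive_def
  by (metis grp_append grp_nf limgs_append sub_grp)

lemma additive_zero:
  assumes "additive f"
  shows "f 0 = 0"
proof -
  have "f (0 + 0) = f 0 + f 0" using assms unfolding additive_def by blast
  then show ?thesis by (metis add.right_neutral add_left_cancel)
qed

lemma additive_uminus:
  assumes "additive f"
  shows "f (- g) = - f g"
proof -
  have "f (- g + g) = f (- g) + f g" using assms unfolding additive_def by blast
  then show ?thesis using additive_zero[OF assms] by (simp add: eq_neg_iff_add_eq_0)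
qed

lemma additive_diff: "additive f \<Longrightarrow> f (g - h) = f g - f h"
  by (metis additive_def additive_uminus diff_conv_add_uminus)

lemma sub_gens [simp]: "sub x y genA = x" "sub x y genB = y"
  by (simp_all add: genA_def genB_def sub_grp)

lemma additive_comp: "additive f \<Longrightarrow> additive g \<Longrightarrow> additive (\<lambda>x. f (g x))"
  by (simp add: additive_def)

lemma additive_conj: "additive f \<Longrightarrow> additive (\<lambda>x. c + f x - c)"
  unfolding additive_def by (simp add: group_add_norm del: add_uminus_conv_diff)

lemma sub_add [simp]: "sub x y (g + h) = sub x y g + sub x y h"
  using additive_sub by (auto simp: additive_def)

lemma sub_uminus [simp]: "sub x y (- g) = - sub x y g"
  by (simp add: additive_sub additive_uminus)

lemma sub_diff [simp]: "sub x y (g - h) = sub x y g - sub x y h"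
  by (simp add: additive_sub additive_diff)

lemma grp_letter: "grp [l] = limg genA genB l"
  by (cases l; cases "fst l"; cases "snd l")
     (auto simp: genA_def genB_def grp_letter_inv[of "(_, True)", unfolded letter_inv_def, simplified])

text \<open>Later identities between endomorphisms are mostly checked on the two generators through
  this rule.\<close>

lemma additive_ext:
  assumes "additive f" "additive h" "f genA = h genA" "f genB = h genB"
  shows "f g = h g"
proof -
  have *: "f (grp [l]) = h (grp [l])" for l
    using assms by (cases l; cases "fst l"; cases "snd l") (auto simp: grp_letter additive_uminus)
  have "f (grp w) = h (grp w)" for w
  proof (induction w)
    case (Cons l w)
    then show ?case using assms * by (metis additive_def grp_Cons)
  qed (use assms in \<open>simp add: additive_zero\<close>)
  then show ?thesis by (metis grp_nf)
qed

lemma additive_eq_sub: "additive f \<Longrightarrow> f g = sub (f genA) (f genB) g"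
  by (rule additive_ext) (simp_all add: additive_sub)

section \<open>Conjugacy in the free group\<close>

definition conj2 :: "free2 \<Rightarrow> free2 \<Rightarrow> bool" (infix "\<sim>" 50) where
  "g \<sim> h \<longleftrightarrow> (\<exists>c. h = c + g - c)"

lemma conj2_refl [simp]: "g \<sim> g"
  unfolding conj2_def by (rule exI[of _ 0]) simp

lemma conj2_sym: "g \<sim> h \<Longrightarrow> h \<sim> g"
  unfolding conj2_def
proof (elim exE)
  fix c assume "h = c + g - c"
  then show "\<exists>c. g = c + h - c"
    by (intro exI[of _ "- c"]) (simp add: group_add_norm del: add_uminus_conv_diff)
qed

lemma conj2_trans [trans]: "g \<sim> h \<Longrightarrow> h \<sim> k \<Longrightarrow> g \<sim> k"
  unfolding conj2_def
proof (elim exE)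
  fix c d assume "h = c + g - c" "k = d + h - d"
  then show "\<exists>c. k = c + g - c"
    by (intro exI[of _ "d + c"]) (simp add: group_add_norm del: add_uminus_conv_diff)
qed

lemma conj2_additive: "additive f \<Longrightarrow> g \<sim> h \<Longrightarrow> f g \<sim> f h"
  unfolding conj2_def by (metis additive_def additive_diff)

lemma conj2_swap: "g + h \<sim> h + g"
  unfolding conj2_def by (rule exI[of _ "- g"]) (simp add: group_add_norm del: add_uminus_conv_diff)

lemma conj2_rotate: "grp w \<sim> grp (rotate n w)"
proof (induction n)
  case (Suc n)
  have "grp v \<sim> grp (rotate1 v)" for v
    by (cases v) (simp_all add: grp_Cons[of _ "tl _"] grp_append, metis conj2_swap grp_Cons)
  then show ?case using Suc conj2_trans by (metis rotate_Suc)
qed simp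

section \<open>Nielsen's theorem in rank two\<close>

fun lcp :: "'a list \<Rightarrow> 'a list \<Rightarrow> nat" where
  "lcp (x # xs) (y # ys) = (if x = y then Suc (lcp xs ys) else 0)"
| "lcp _ _ = 0"

lemma lcp_commute: "lcp xs ys = lcp ys xs"
  by (induction xs ys rule: lcp.induct) auto

lemma lcp_self [simp]: "lcp xs xs = length xs"
  by (induction xs) auto

lemma lcp_ultra: "lcp xs zs \<ge> min (lcp xs ys) (lcp ys zs)"
proof (induction xs ys arbitrary: zs rule: lcp.induct)
  case (1 x xs y ys)
  then show ?case by (cases zs) auto
qed auto

lemma lcp_le: "lcp xs ys \<le> length xs" "lcp xs ys \<le> length ys"
  by (induction xs ys rule: lcp.induct) auto

text \<open>Triangles are isosceles for the ultrametric inequality \<open>lcp_ultra\<close>.\<close>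

lemma lcp_eq_if_less:
  assumes "lcp ys zs < lcp xs ys"
  shows "lcp xs zs = lcp ys zs"
  using assms lcp_ultra[of xs ys zs] lcp_ultra[of ys xs zs] by (auto simp: lcp_commute[of ys xs])

lemma lcp_splitE:
  obtains p u v where "xs = p @ u" "ys = p @ v" "length p = lcp xs ys"
    "u \<noteq> [] \<Longrightarrow> v \<noteq> [] \<Longrightarrow> hd u \<noteq> hd v"
proof -
  have "\<exists>p u v. xs = p @ u \<and> ys = p @ v \<and> length p = lcp xs ys \<and>
    (u \<noteq> [] \<longrightarrow> v \<noteq> [] \<longrightarrow> hd u \<noteq> hd v)"
  proof (induction xs ys rule: lcp.induct)
    case (1 x xs y ys)
    show ?case
    proof (cases "x = y")
      case True
      then obtain p u v where "xs = p @ u" "ys = p @ v" "length p = lcp xs ys"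
        "u \<noteq> [] \<longrightarrow> v \<noteq> [] \<longrightarrow> hd u \<noteq> hd v" using 1 by blast
      then show ?thesis using True
        by (intro exI[of _ "x # p"] exI[of _ u] exI[of _ v]) simp
    next
      case False
      then show ?thesis
        by (intro exI[of _ "[]"] exI[of _ "x # xs"] exI[of _ "y # ys"]) simp
    qed
  qed auto
  then show ?thesis using that by blast
qed

section \<open>Word length and cancellation in products\<close>

definition len :: "free2 \<Rightarrow> nat" where "len g = length (nf g)"

lemma len_grp_le: "len (grp w) \<le> length w"
  by (simp add: len_def length_reduce_le)

lemma len_uminus [simp]: "len (- g) = len g"
  by (simp add: len_def nf_uminus)

lemma nf_zero [simp]: "nf 0 = []"
  unfolding zero_free2_def nf_grp by simp

lemma len_zero [simp]: "len 0 = 0"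
  by (simp add: len_def)

lemma len_eq_0_iff [simp]: "len g = 0 \<longleftrightarrow> g = 0"
  by (metis grp_Nil grp_nf len_def len_zero length_0_conv)

text \<open>The common prefix is exactly what cancels, once from each factor.\<close>

lemma len_minus_plus: "len (- g + h) + 2 * lcp (nf g) (nf h) = len g + len h"
proof -
  obtain p u v where *: "nf g = p @ u" "nf h = p @ v" "length p = lcp (nf g) (nf h)"
    "u \<noteq> [] \<Longrightarrow> v \<noteq> [] \<Longrightarrow> hd u \<noteq> hd v"
    using lcp_splitE[of "nf g" "nf h"] by blast
  have "g = grp p + grp u" "h = grp p + grp v"
    using * grp_append by (metis grp_nf)+
  then have "- g + h = grp (word_inv u @ v)"
    by (simp add: grp_append grp_word_inv group_add_norm del: add_uminus_conv_diff)
  moreover have "reduced u" "reduced v"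
    using * reduced_nf reduced_append by metis+
  then have "reduced (word_inv u @ v)"
    using *(4) by (auto simp: reduced_append last_rev hd_map)
  ultimately show ?thesis
    using *(1-3) by (simp add: len_def reduce_id)
qed

lemma lcp_nth: "i < lcp xs ys \<Longrightarrow> xs ! i = ys ! i"
proof (induction xs ys arbitrary: i rule: lcp.induct)
  case (1 x xs y ys)
  then show ?case by (cases i) (auto split: if_splits)
qed auto

text \<open>Otherwise the reduced word of \<open>h\<close> would be its own mirrored inverse up to
  the middle: an even length gives two adjacent inverse letters, an odd length a letter equal to its
  inverse.\<close>

lemma lcp_uminus_less:
  assumes "h \<noteq> 0"
  shows "2 * lcp (nf (- h)) (nf h) < len h"
proof (rule ccontr)
  define w where "w = nf h"
  define k where "k = length w div 2"
  assume "\<not> ?thesis"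
  then have l: "length w \<le> 2 * lcp (word_inv w) w" by (simp add: w_def len_def nf_uminus)
  have inv: "w ! i = letter_inv (w ! (length w - 1 - i))" if "i < lcp (word_inv w) w" for i
  proof -
    have "i < length w" using that lcp_le(2)[of "word_inv w" w] by linarith
    then show ?thesis using lcp_nth[OF that] by (simp add: rev_nth)
  qed
  show False
  proof (cases "even (length w)")
    case True
    have "length w \<noteq> 0" using assms by (simp add: w_def flip: len_def)
    then have k: "0 < k" "length w = 2 * k" using True unfolding k_def by presburger+
    then have "w ! (k - 1) = letter_inv (w ! k)" using inv[of "k - 1"] l by auto
    moreover have "Suc (k - 1) < length w" using k by simp
    then have "w ! Suc (k - 1) \<noteq> letter_inv (w ! (k - 1))"
      using reduced_nf[of h] unfolding reduced_def successively_conv_nth w_def[symmetric] by blast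
    ultimately show False using k by simp
  next
    case False
    then have k: "length w = 2 * k + 1" by (auto simp: k_def elim: oddE)
    then show False using inv[of k] l by auto
  qed
qed

inductive nielsen :: "free2 \<Rightarrow> free2 \<Rightarrow> free2 \<Rightarrow> free2 \<Rightarrow> bool" for x y where
  refl: "nielsen x y x y"
| swap: "nielsen x y p q \<Longrightarrow> nielsen x y q p"
| neg: "nielsen x y p q \<Longrightarrow> nielsen x y (- p) q"
| add: "nielsen x y p q \<Longrightarrow> nielsen x y (p + q) q"
| conj: "nielsen x y p q \<Longrightarrow> nielsen x y (c + p - c) (c + q - c)"

text \<open>A letter indexes one of \<open>p\<close>, \<open>q\<close> and their inverses, so later
  arguments can treat signs and the order of the pair uniformly.\<close>

lemma nielsen_signs: "nielsen x y p q \<Longrightarrow> nielsen x y (limg p q l) (limg p q l')"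
  if "fst l \<noteq> fst l'" for l l'
proof -
  assume N: "nielsen x y p q"
  then have 1: "nielsen x y p (- q)" "nielsen x y (- p) (- q)" "nielsen x y (- p) q"
    using nielsen.swap nielsen.neg by blast+
  note 2 = this[THEN nielsen.swap] N[THEN nielsen.swap]
  show ?thesis using that
    by (cases l; cases l'; cases "fst l"; cases "fst l'"; cases "snd l"; cases "snd l'")
       (simp_all add: N 1 2)
qed

lemma surj_sub_swap:
  assumes "surj (sub p q)"
  shows "surj (sub q p)"
proof -
  have "sub p q u = sub q p (sub genB genA u)" for u
    by (rule additive_ext[of "sub p q" "\<lambda>u. sub q p (sub genB genA u)"])
       (simp_all add: additive_comp additive_sub)
  then show ?thesis using assms by (metis surj_def)
qed

text \<open>Each move composes the substitution with an automorphism: on the argument side for the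
  elementary moves, on the value side for conjugation.\<close>

lemma nielsen_surj:
  assumes "nielsen x y p q" "surj (sub x y)"
  shows "surj (sub p q)"
  using assms
proof induction
  case (neg p q)
  have "sub p q u = sub (- p) q (sub (- genA) genB u)" for u
    by (rule additive_ext[of "sub p q"]) (simp_all add: additive_comp additive_sub)
  then show ?case using neg by (metis surj_def)
next
  case (add p q)
  have "sub p q u = sub (p + q) q (sub (genA - genB) genB u)" for u
    by (rule additive_ext[of "sub p q"]) (simp_all add: additive_comp additive_sub)
  then show ?case using add by (metis surj_def)
next
  case (conj p q c)
  have *: "sub (c + p - c) (c + q - c) u = c + sub p q u - c" for u
    by (rule additive_ext[of _ "\<lambda>u. c + sub p q u - c"])
      (simp_all add: additive_conj additive_sub)
  have "\<exists>u. v = sub (c + p - c) (c + q - c) u" for v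
  proof -
    obtain u where u: "sub p q u = - c + v + c" using conj by (metis surj_def)
    have "c + (- c + v + c) - c = v"
      by (simp add: add.assoc)
    then show ?thesis by (metis * u)
  qed
  then show ?case by (simp add: surj_def)
qed (simp_all add: surj_sub_swap)

lemma genA_neq_genB [simp]: "genA \<noteq> genB" "genB \<noteq> genA" "genA \<noteq> - genB" "genB \<noteq> - genA"
  by (auto simp: genA_def genB_def grp_eq_iff reduce_id letter_inv_def simp flip: grp_letter_inv)

text \<open>All values are multiples of \<open>q\<close>. If they were everything, \<open>q\<close>
  would be central and then the group commutative, but the two generators do not commute.\<close>

lemma not_surj_sub_zero: "\<not> surj (sub 0 q)"
proof
  assume surj: "surj (sub 0 q)"
  have comm: "limgs 0 q w + q = q + limgs 0 q w" for w
  proof (induction w)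
    case (Cons l w)
    have "limg 0 q l + q = q + limg 0 q l"
      by (cases l; cases "fst l"; cases "snd l") auto
    then show ?case using Cons by (metis add.assoc limgs_Cons)
  qed simp
  have q: "g + q = q + g" for g
    using surjD[OF surj, of g] comm unfolding sub_def by auto
  have "g + - q = - q + g" for g
  proof -
    have "g + - q = - q + (q + g) + - q" by (simp only: minus_add_cancel)
    also have "\<dots> = - q + g"
      unfolding q[symmetric] by (simp only: add.assoc right_minus add.right_neutral)
    finally show ?thesis .
  qed
  then have central: "g + limg 0 q l = limg 0 q l + g" for g l
    by (cases l; cases "fst l"; cases "snd l") (simp_all add: q del: add_uminus_conv_diff)
  have "g + limgs 0 q w = limgs 0 q w + g" for g w
    by (induction w) (auto, metis central add.assoc)
  moreover obtain u where "genB = limgs 0 q (nf u)"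
    using surjD[OF surj, of genB] unfolding sub_def by blast
  ultimately have "genA + genB = genB + genA" by metis
  then show False
    by (simp add: genA_def genB_def grp_eq_iff reduce_id reduced_Cons letter_inv_def
        flip: grp_append)
qed

text \<open>If \<open>h\<close> is cancelled by halves from both sides in \<open>g + h + g\<close>, then the pair \<open>(g, h)\<close> is not
  minimal up to simultaneous conjugation. This replaces the ordering of words that settles ties in
  the usual form of Nielsen reduction.\<close>

lemma conjugation_shortens:
  assumes r: "len h = 2 * r" "2 * r \<le> len g"
    and "lcp (nf (- g)) (nf h) = r" "lcp (nf (- h)) (nf g) = r"
  shows "\<exists>c. len (c + (g + h) - c) + len (c + h - c) \<le> len g"
proof -
  obtain P u Q' where P: "nf (- g) = P @ u" "nf h = P @ Q'" "length P = r"
    by (rule lcp_splitE[of "nf (- g)" "nf h"]) (use assms in auto)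
  obtain Q v z where Q: "nf (- h) = Q @ v" "nf g = Q @ z" "length Q = r"
    by (rule lcp_splitE[of "nf (- h)" "nf g"]) (use assms in auto)
  have "word_inv Q' @ word_inv P = Q @ v" using P Q by (simp add: nf_uminus)
  moreover have "length Q' = r" using P r by (simp add: len_def)
  ultimately have Q': "word_inv Q' = Q" using Q by (metis append_eq_append_conv length_map length_rev)
  then have "Q' = word_inv Q" by (simp add: rev_map flip: Q') (simp add: o_def)
  then have h: "h = grp P - grp Q" using P
    by (metis diff_conv_add_uminus grp_append grp_nf grp_word_inv)
  have gu: "Q @ z = word_inv u @ word_inv P"
    using P(1) Q(2) by (metis add.inverse_inverse map_append nf_uminus rev_append)
  then have z: "z = drop r (word_inv u) @ word_inv P"
  proof -
    have "r \<le> length u" using P r by (simp add: len_def nf_uminus[of g, symmetric])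
        (metis P(1) add_le_imp_le_left len_def len_uminus length_append mult_2)
    then show ?thesis using arg_cong[OF gu, of "drop r"] Q(3) by simp
  qed
  \<comment> \<open>Now \<open>h\<close> is \<open>P\<close> times the inverse of \<open>Q\<close>,
    and \<open>g\<close> is \<open>Q\<close> times \<open>t\<close> times the inverse of
    \<open>P\<close>. Conjugating by the inverse of \<open>Q\<close> leaves \<open>t\<close> from
    \<open>g + h\<close> and the inverse of \<open>Q\<close> times \<open>P\<close> from
    \<open>h\<close>.\<close>
  define t where "t = drop r (word_inv u)"
  have g: "g = grp Q + grp t - grp P"
    using Q(2) z by (metis add.assoc diff_conv_add_uminus grp_append grp_nf grp_word_inv t_def)
  have lt: "length t + 2 * r = len g"
    using Q z P(3) by (simp add: len_def t_def)
  have 1: "- grp Q + (g + h) - (- grp Q) = grp t"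
    by (simp add: g h group_add_norm del: add_uminus_conv_diff)
  have 2: "- grp Q + h - (- grp Q) = grp (word_inv Q @ P)"
    by (simp add: g h grp_append grp_word_inv group_add_norm del: add_uminus_conv_diff)
  have "len (grp t) + len (grp (word_inv Q @ P)) \<le> len g"
    using len_grp_le[of t] len_grp_le[of "word_inv Q @ P"] lt P Q by simp
  then show ?thesis by (intro exI[of _ "- grp Q"]) (simp only: 1 2)
qed

section \<open>Pairs of minimal total length\<close>

locale nielsen_minimal =
  fixes x y p q :: free2
  assumes reach: "nielsen x y p q"
    and surj: "surj (sub p q)"
    and minimal: "\<And>p' q'. nielsen x y p' q' \<Longrightarrow> len p + len q \<le> len p' + len q'"
begin

text \<open>The number of letters each factor loses when the inverse of \<open>limg p q l\<close> is
  multiplied by \<open>limg p q l'\<close>.\<close>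

definition m :: "letter \<Rightarrow> letter \<Rightarrow> nat" where
  "m l l' = lcp (nf (limg p q l)) (nf (limg p q l'))"

abbreviation L :: "letter \<Rightarrow> nat" where
  "L l \<equiv> len (limg p q l)"

lemma L_pos: "0 < L l"
proof -
  have "p \<noteq> 0" "q \<noteq> 0" using surj surj_sub_swap not_surj_sub_zero by blast+
  then show ?thesis
    by (cases l; cases "fst l"; cases "snd l") (auto simp: neq0_conv[symmetric] simp del: neq0_conv)
qed

lemma L_letter_inv [simp]: "L (letter_inv l) = L l"
  by (simp add: limg_letter_inv)

lemma L_total: "fst l \<noteq> fst l' \<Longrightarrow> L l + L l' = len p + len q"
  by (cases l; cases l'; cases "fst l"; cases "fst l'"; cases "snd l"; cases "snd l'") auto

text \<open>Minimality is applied to the pair in which the product replaces one factor; the second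
  bound is the first one for the inverse product.\<close>

lemma L_sum_ge:
  assumes "fst l \<noteq> fst l'"
  shows "L l \<le> len (limg p q l + limg p q l')" "L l' \<le> len (limg p q l + limg p q l')"
proof -
  have *: "L l \<le> len (limg p q l + limg p q l')" if "fst l \<noteq> fst l'" for l l'
    using minimal[OF nielsen.add[OF nielsen_signs[OF that reach]]] L_total[OF that] by simp
  show "L l \<le> len (limg p q l + limg p q l')" by (rule *[OF assms])
  have "len (limg p q l + limg p q l') = len (limg p q (letter_inv l') + limg p q (letter_inv l))"
    by (metis len_uminus limg_letter_inv minus_add)
  then show "L l' \<le> len (limg p q l + limg p q l')"
    using *[of "letter_inv l'" "letter_inv l"] assms by (metis L_letter_inv fst_conv letter_inv_def)
qed

lemma m_commute: "m l l' = m l' l"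
  by (simp add: m_def lcp_commute)

lemma m_letter_inv: "2 * m (letter_inv l) l < L l"
proof -
  have "limg p q l \<noteq> 0" using L_pos[of l] by auto
  from lcp_uminus_less[OF this] show ?thesis by (simp add: m_def limg_letter_inv)
qed

lemma letters_cases: "l \<noteq> l' \<Longrightarrow> l' = letter_inv l \<or> fst l \<noteq> fst l'"
  by (cases l; cases l') (auto simp: letter_inv_def)

text \<open>A factor loses at most half of itself at a junction: for distinct generators this is
  \<open>L_sum_ge\<close> read through \<open>len_minus_plus\<close>, for a repeated factor it is
  \<open>m_letter_inv\<close>.\<close>

lemma m_le:
  assumes "l \<noteq> l'"
  shows "2 * m l l' \<le> L l" "2 * m l l' \<le> L l'"
proof -
  have "2 * m l l' \<le> L l \<and> 2 * m l l' \<le> L l'"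
  proof (cases "l' = letter_inv l")
    case True
    then show ?thesis using m_letter_inv[of l] by (simp add: m_commute[of l])
  next
    case False
    then have "fst (letter_inv l) \<noteq> fst l'" using letters_cases[OF assms] by (simp add: letter_inv_def)
    from L_sum_ge[OF this] show ?thesis
      using len_minus_plus[of "limg p q l" "limg p q l'"] by (simp add: limg_letter_inv m_def)
  qed
  then show "2 * m l l' \<le> L l" "2 * m l l' \<le> L l'" by auto
qed

text \<open>Some part of the factor \<open>h\<close> survives cancellation from both sides. Each
  side takes at most half, so only an exact tie needs an argument.\<close>

lemma m_sum_less:
  assumes "l \<noteq> h" "k \<noteq> letter_inv h"
  shows "m l h + m (letter_inv h) k < L h"
proof (rule ccontr)
  assume "\<not> ?thesis"
  moreover have le: "2 * m l h \<le> L l" "2 * m l h \<le> L h"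
    "2 * m (letter_inv h) k \<le> L h" "2 * m (letter_inv h) k \<le> L k"
    using m_le[OF assms(1)] m_le[OF assms(2)[symmetric]] by auto
  ultimately have eq: "2 * m l h = L h" "2 * m (letter_inv h) k = L h" by auto
  have "l \<noteq> letter_inv h" using eq m_letter_inv[of h] by auto
  then have l: "fst l \<noteq> fst h" using letters_cases assms by (metis letter_inv_inv)
  have "k \<noteq> h" using eq m_letter_inv[of h] by auto
  then have k: "fst k \<noteq> fst h" using letters_cases assms by metis
  have "fst l = fst k" using l k by (cases "fst l"; cases "fst k"; cases "fst h") auto
  show False
  proof (cases "k = l")
    case True
    \<comment> \<open>The factor of \<open>l\<close> shares a half with that of \<open>h\<close> and
      with its inverse, so these two would share a half as well, against
      \<open>m_letter_inv\<close>.\<close>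
    have "min (m (letter_inv h) l) (m l h) \<le> m (letter_inv h) h"
      unfolding m_def by (rule lcp_ultra)
    then show False using True eq m_letter_inv[of h] by (auto simp: min_def split: if_splits)
  next
    case False
    then have lk: "l = letter_inv k" using letters_cases \<open>fst l = fst k\<close> by (metis letter_inv_inv)
    \<comment> \<open>The factor of \<open>h\<close> is cancelled by halves from both sides by the
      factor of \<open>k\<close>. The conjugated pair has total length at most \<open>L k\<close>,
      which is below the minimum because \<open>L h\<close> is positive.\<close>
    have "\<exists>c. len (c + (limg p q k + limg p q h) - c) + len (c + limg p q h - c) \<le> L k"
      by (rule conjugation_shortens[where r = "m l h"])
         (use eq le lk in \<open>simp_all add: m_def flip: limg_letter_inv\<close>)
    then obtain c where
      "len (c + (limg p q k + limg p q h) - c) + len (c + limg p q h - c) \<le> L k" by blast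
    moreover have "nielsen x y (c + (limg p q k + limg p q h) - c) (c + limg p q h - c)"
      by (intro nielsen.conj nielsen.add nielsen_signs[OF k reach])
    ultimately show False using minimal L_total[OF k] L_pos[of h] by fastforce
  qed
qed

text \<open>What the factor of \<open>l\<close> loses to the last factor of \<open>w\<close>; an
  empty product takes nothing, hence the \<open>0\<close>.\<close>

definition overlap :: "word \<Rightarrow> letter \<Rightarrow> nat" where
  "overlap w l = (if w = [] then 0 else m (letter_inv (last w)) l)"

text \<open>The middle part says that the product ends with all of its last factor except what that factor
  loses to the factor before it.\<close>

lemma len_limgs_snoc:
  assumes "reduced (w @ [l])"
  shows "overlap w l < L l \<and>
    lcp (nf (- limgs p q (w @ [l]))) (nf (- limg p q l)) + overlap w l = L l \<and>
    length w + L l \<le> len (limgs p q (w @ [l])) + overlap w l"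
  using assms
proof (induction w arbitrary: l rule: rev_induct)
  case Nil
  then show ?case using L_pos[of l] by (simp add: overlap_def len_def nf_uminus)
next
  case (snoc k w)
  define s where "s = limgs p q (w @ [k])"
  define d' where "d' = overlap w k"
  define e where "e = m (letter_inv k) l"
  have kl: "l \<noteq> letter_inv k" "reduced (w @ [k])" using snoc.prems by (auto simp: reduced_append reduced_Cons)
  have IH: "d' < L k" "lcp (nf (- s)) (nf (- limg p q k)) + d' = L k"
    "length w + L k \<le> len s + d'"
    using snoc.IH[OF kl(2)] by (simp_all add: d'_def s_def)
  have el: "2 * e \<le> L l" "2 * e \<le> L k" using m_le[OF kl(1)] by (auto simp: e_def m_commute)
  have "d' + e < L k"
  proof (cases "w = []")
    case True
    then show ?thesis using el L_pos[of k] by (simp add: d'_def overlap_def)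
  next
    case False
    have "letter_inv (last w) \<noteq> k" using kl(2) False by (auto simp: reduced_append)
    then show ?thesis using m_sum_less[of "letter_inv (last w)" k l] kl False
      by (simp add: d'_def e_def overlap_def)
  qed
  moreover have "lcp (nf (- limg p q k)) (nf (limg p q l)) = e"
    by (simp add: e_def m_def limg_letter_inv)
  \<comment> \<open>By the induction hypothesis more than \<open>e\<close> letters at the end of the
    factor of \<open>k\<close> survive in \<open>s\<close>. By the isosceles property
    \<open>s\<close> cancels against the factor of \<open>l\<close> exactly as that factor
    does.\<close>
  ultimately have lc: "lcp (nf (- s)) (nf (limg p q l)) = e"
    using lcp_eq_if_less[of "nf (- limg p q k)" "nf (limg p q l)" "nf (- s)"] IH by auto
  have st: "limgs p q ((w @ [k]) @ [l]) = s + limg p q l"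
    by (simp only: limgs_append s_def) simp
  have len: "len (s + limg p q l) + 2 * e = len s + L l"
    using len_minus_plus[of "- s" "limg p q l"] lc by simp
  have "len s + 2 * lcp (nf (- (s + limg p q l))) (nf (- limg p q l)) = len (s + limg p q l) + L l"
  proof -
    have "- (- (s + limg p q l)) + - limg p q l = s" by (simp add: add.assoc)
    then show ?thesis
      using len_minus_plus[of "- (s + limg p q l)" "- limg p q l"] by (simp only: len_uminus)
  qed
  then show ?case
    unfolding st using len el IH \<open>d' + e < L k\<close> L_pos[of l] by (simp add: e_def overlap_def)
qed

lemma len_limgs_ge:
  assumes "reduced w"
  shows "length w \<le> len (limgs p q w)"
proof (cases w rule: rev_cases)
  case (snoc v l)
  then show ?thesis using len_limgs_snoc[of v l] assms by auto
qed simp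

text \<open>A letter has length one, so by \<open>len_limgs_ge\<close> it is a product of at most
  one factor; being nontrivial, it is not the empty product.\<close>

lemma letter_image: "\<exists>l. grp [l'] = limg p q l"
proof -
  obtain u where u: "grp [l'] = sub p q u" using surj by (metis surj_def)
  then have "length (nf u) \<le> 1"
    using len_limgs_ge[of "nf u"] len_grp_le[of "[l']"] by (simp add: sub_def)
  moreover have "nf u \<noteq> []"
    using u by (auto simp: sub_def reduce_id grp_eq_iff simp flip: grp_Nil)
  ultimately obtain l where "nf u = [l]" by (cases "nf u") auto
  then have "grp [l'] = limg p q l" using u by (simp add: sub_def)
  then show ?thesis by blast
qed

lemma reach_gens: "nielsen x y genA genB"
proof -
  obtain l l' where l: "genA = limg p q l" "genB = limg p q l'"
    using letter_image unfolding genA_def genB_def by metis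
  have "fst l \<noteq> fst l'"
  proof
    assume "fst l = fst l'"
    then have "l' = l \<or> l' = letter_inv l" using letters_cases by metis
    then show False using l by (auto simp: limg_letter_inv)
  qed
  from nielsen_signs[OF this reach] show ?thesis by (simp only: l)
qed

end

theorem nielsen_generators:
  assumes "surj (sub x y)"
  shows "nielsen x y genA genB"
proof -
  let ?P = "\<lambda>(p, q). nielsen x y p q"
  obtain pq where "?P pq" "\<And>r. ?P r \<Longrightarrow> len (fst pq) + len (snd pq) \<le> len (fst r) + len (snd r)"
    using ex_has_least_nat[of ?P "(x, y)" "\<lambda>r. len (fst r) + len (snd r)"] nielsen.refl by blast
  then have "nielsen_minimal x y (fst pq) (snd pq)"
    using nielsen_surj[OF _ assms] by unfold_locales (auto split: prod.splits)
  then show ?thesis by (rule nielsen_minimal.reach_gens)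
qed

section \<open>Conjugacy of cyclically reduced words\<close>

lemma rotate_invariant:
  assumes "\<And>l w. P (l # w) \<Longrightarrow> P (w @ [l])" "P w"
  shows "P (rotate n w)"
proof (induction n)
  case (Suc n)
  then show ?case using assms(1) by (cases "rotate n w") auto
qed (use assms in simp)

text \<open>Repeating the first letter at the end turns the wrap-around condition into ordinary
  reducedness.\<close>

lemma cyclically_reduced_iff: "cyclically_reduced w \<longleftrightarrow> w = [] \<or> reduced (w @ [hd w])"
  by (auto simp: cyclically_reduced_def reduced_append)

lemma cyclically_reduced_rotate: "cyclically_reduced w \<Longrightarrow> cyclically_reduced (rotate n w)"
proof (erule rotate_invariant[rotated])
  fix l w
  assume "cyclically_reduced (l # w)"
  then have *: "reduced (w @ [l])" "hd (w @ [l]) \<noteq> letter_inv l"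
    by (auto simp: cyclically_reduced_iff reduced_Cons)
  then have "reduced ((w @ [l]) @ [hd (w @ [l])])"
    by (simp only: reduced_append[of "w @ [l]"]) simp
  then show "cyclically_reduced (w @ [l])"
    by (simp only: cyclically_reduced_iff) simp
qed

lemma reduced_grp_inject: "reduced v \<Longrightarrow> reduced w \<Longrightarrow> grp v = grp w \<longleftrightarrow> v = w"
  by (simp add: grp_eq_iff reduce_id)

text \<open>The conjugator is consumed from its right end: its last letter either cancels against an
  end of \<open>v\<close>, which rotates \<open>v\<close>, or cancels nowhere.\<close>

lemma cyclically_reduced_conjugate_aux:
  assumes "cyclically_reduced v" "cyclically_reduced w" "reduced c"
    and "grp w = grp c + grp v - grp c"
  shows "\<exists>n. w = rotate n v"
  using assms
proof (induction c arbitrary: v rule: rev_induct)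
  case Nil
  then have "w = v" by (simp add: reduced_grp_inject cyclically_reduced_def)
  then show ?case by (intro exI[of _ 0]) simp
next
  case (snoc x c)
  have c: "reduced c" using snoc.prems by (simp add: reduced_append)
  have red: "reduced v" "reduced w" using snoc.prems by (simp_all add: cyclically_reduced_def)
  have gw: "grp w = grp c + (grp [x] + grp v - grp [x]) - grp c"
    using snoc.prems(4) by (simp add: grp_append group_add_norm del: add_uminus_conv_diff)
  consider "v = []" | v1 where "v = letter_inv x # v1" | v1 where "v = v1 @ [x]"
    | "v \<noteq> []" "hd v \<noteq> letter_inv x" "last v \<noteq> x"
    by (metis append_butlast_last_id list.collapse)
  then show ?case
  proof cases
    case 1
    then have "w = []" using gw red by (simp add: reduced_grp_inject[of w "[]", symmetric])
    then show ?thesis using 1 by simp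
  next
    case 2
    have "grp [x] + grp v - grp [x] = grp (rotate1 v)"
      by (simp add: 2 grp_append grp_Cons[of "letter_inv x" v1] grp_letter_inv group_add_norm
          del: add_uminus_conv_diff)
    with gw have "\<exists>n. w = rotate n (rotate1 v)"
      using snoc.IH[of "rotate1 v"] c snoc.prems cyclically_reduced_rotate[of v 1] by simp
    then show ?thesis by (metis rotate_Suc rotate1_rotate_swap)
  next
    case 3
    define v' where "v' = x # v1"
    have v': "v' = rotate (length v1) v" "v = rotate1 v'"
      by (simp_all add: v'_def 3 rotate_append)
    have "grp [x] + grp v - grp [x] = grp v'"
      by (simp add: v'_def 3 grp_append grp_Cons[of x v1] group_add_norm del: add_uminus_conv_diff)
    with gw have "\<exists>n. w = rotate n v'"
      using snoc.IH[of v'] c snoc.prems cyclically_reduced_rotate[of v "length v1"] v'(1) by simp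
    then show ?thesis using v'(1) by (metis rotate_rotate)
  next
    case 4
    have "letter_inv (last v) \<noteq> letter_inv x" using 4 by simp
    \<comment> \<open>Nothing cancels, so \<open>w\<close> begins with the first letter of the
      conjugator and ends with its inverse, which cyclic reducedness forbids.\<close>
    then have r: "reduced ((c @ [x]) @ v @ word_inv (c @ [x]))"
      using 4 red snoc.prems(3) by (auto simp: reduced_append reduced_Cons hd_append hd_rev last_map)
    have "grp w = grp ((c @ [x]) @ v @ word_inv (c @ [x]))"
      unfolding snoc.prems(4) grp_append[of "c @ [x]"] grp_append[of v] grp_word_inv
      by (simp add: add_diff_eq)
    then have w: "w = (c @ [x]) @ v @ word_inv (c @ [x])"
      using r red reduced_grp_inject by blast
    have "hd w = hd (c @ [x])" "last w = letter_inv (hd (c @ [x]))"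
      unfolding w by (auto simp: last_rev hd_map hd_append last_append)
    then show ?thesis using snoc.prems(2) w by (auto simp: cyclically_reduced_def)
  qed
qed

theorem cyclically_reduced_conjugate:
  assumes "cyclically_reduced v" "cyclically_reduced w" "grp v \<sim> grp w"
  shows "\<exists>n. w = rotate n v"
proof -
  obtain c where "grp w = c + grp v - c" using assms by (auto simp: conj2_def)
  then show ?thesis
    using cyclically_reduced_conjugate_aux[of v w "nf c"] assms by simp
qed

lemma ex_cyclically_reduced: "\<exists>w. cyclically_reduced w \<and> g \<sim> grp w"
proof -
  have "reduced v \<Longrightarrow> \<exists>w. cyclically_reduced w \<and> grp v \<sim> grp w" for v
  proof (induction v rule: length_induct)
    case (1 v)
    show ?case
    proof (cases "cyclically_reduced v")
      case False
      then have v: "v \<noteq> []" "hd v = letter_inv (last v)"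
        using 1 by (auto simp: cyclically_reduced_def)
      then obtain l u where u: "v = letter_inv l # u @ [l]"
        by (cases v; cases "tl v" rule: rev_cases) auto
      have "reduced u" using 1(2) u by (simp add: reduced_Cons reduced_append)
      then obtain w where w: "cyclically_reduced w" "grp u \<sim> grp w"
      proof -
        have "length u < length v" using u by simp
        then show ?thesis using 1(1) \<open>reduced u\<close> that by blast
      qed
      have "grp v \<sim> grp (rotate1 v)" using conj2_rotate[of v 1] by simp
      also have "grp (rotate1 v) = grp u"
      proof -
        have "rotate1 v = u @ [l] @ [letter_inv l]" by (simp add: u)
        then show ?thesis by (simp only: grp_append grp_letter_inv) simp
      qed
      finally show ?thesis using w conj2_trans by blast
    qed (use conj2_refl in blast)
  qed
  from this[OF reduced_nf] show ?thesis by simp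
qed

section \<open>Opposed letters and isolated syllables\<close>

fun oth :: "gen \<Rightarrow> gen" where
  "oth GenA = GenB"
| "oth GenB = GenA"

lemma oth_neq [simp]: "oth x \<noteq> x" "x \<noteq> oth x"
  by (cases x; simp)+

lemma oth_oth [simp]: "oth (oth x) = x"
  by (cases x) auto

lemma neq_oth: "y \<noteq> x \<longleftrightarrow> y = oth x"
  by (cases x; cases y) auto

definition gl :: "gen \<Rightarrow> free2" where "gl x = grp [(x, True)]"

lemma grp_False: "grp [(x, False)] = - gl x"
  using grp_letter_inv[of "(x, True)"] by (simp add: letter_inv_def gl_def)

fun twist :: "gen \<Rightarrow> free2 \<Rightarrow> free2" where
  "twist GenA = sub (genA + genB) genB"
| "twist GenB = sub genA (genB + genA)"

lemma additive_twist: "additive (twist x)"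
  by (cases x) (simp_all add: additive_sub)

lemma twist_add [simp]: "twist x (g + h) = twist x g + twist x h"
  and twist_uminus [simp]: "twist x (- g) = - twist x g"
  and twist_zero [simp]: "twist x 0 = 0"
  using additive_twist[of x] additive_uminus additive_zero by (auto simp: additive_def)

lemma twist_gl [simp]: "twist x (gl x) = gl x + gl (oth x)" "twist x (gl (oth x)) = gl (oth x)"
  by (cases x; simp add: gl_def flip: genA_def genB_def)+

text \<open>Words are read from right to left. The state is the first letter of the part already read,
  together with whether that letter is opposed. A cyclic word \<open>w\<close> is read from a state \<open>s\<close> that
  satisfies \<open>state w s = s\<close>.\<close>

type_synonym state = "letter \<times> bool"

text \<open>Equal neighbours lie in one syllable and share the flag; in a reduced word a change of
  letter is a change of syllable.\<close>

definition step :: "letter \<Rightarrow> state \<Rightarrow> state" where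
  "step l s = (l, if l = fst s then snd s else snd l \<noteq> snd (fst s))"

definition state :: "word \<Rightarrow> state \<Rightarrow> state" where
  "state w s = foldr step w s"

lemma state_simps [simp]:
  "state [] s = s" "state (l # w) s = step l (state w s)" "state (v @ w) s = state v (state w s)"
  by (simp_all add: state_def)

fun opposed :: "word \<Rightarrow> state \<Rightarrow> nat" where
  "opposed [] s = 0"
| "opposed (l # w) s = of_bool (snd (step l (state w s))) + opposed w s"

text \<open>An isolated syllable is recognised when the letter in front of it is read.\<close>

definition isolates :: "gen \<Rightarrow> letter \<Rightarrow> state \<Rightarrow> bool" where
  "isolates y l s \<longleftrightarrow> fst (fst s) = y \<and> fst l \<noteq> y \<and> snd l \<noteq> snd (fst s) \<and> snd s"

fun isolated :: "gen \<Rightarrow> word \<Rightarrow> state \<Rightarrow> bool" where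
  "isolated y [] s \<longleftrightarrow> False"
| "isolated y (l # w) s \<longleftrightarrow> isolates y l (state w s) \<or> isolated y w s"

lemma opposed_append: "opposed (v @ w) s = opposed v (state w s) + opposed w s"
  by (induction v) auto

lemma isolated_append: "isolated y (v @ w) s \<longleftrightarrow> isolated y v (state w s) \<or> isolated y w s"
  by (induction v) auto

lemma opposed_le_length: "opposed w s \<le> length w"
  by (induction w) auto

definition uniform :: "gen \<Rightarrow> word \<Rightarrow> bool" where
  "uniform y w \<longleftrightarrow> (\<exists>e. \<forall>l\<in>set w. fst l = y \<longrightarrow> snd l = e)"

text \<open>When the first letter moves to the end, the new fixed state is the one reached just
  before that letter was read.\<close>

lemma rotate_state:
  assumes "state w s = s"
  obtains s' where "state (rotate n w) s' = s'" "opposed (rotate n w) s' = opposed w s"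
    "\<And>y. isolated y (rotate n w) s' = isolated y w s"
proof -
  define P where "P v \<longleftrightarrow> (\<exists>s'. state v s' = s' \<and> opposed v s' = opposed w s \<and>
    (\<forall>y. isolated y v s' = isolated y w s))" for v
  have "P (rotate n w)"
  proof (rule rotate_invariant)
    show "P w" using assms unfolding P_def by blast
    fix l v assume "P (l # v)"
    then obtain t where "state (l # v) t = t" "opposed (l # v) t = opposed w s"
      "\<forall>y. isolated y (l # v) t = isolated y w s" by (auto simp: P_def)
    then show "P (v @ [l])"
      unfolding P_def by (intro exI[of _ "state v t"]) (auto simp: opposed_append isolated_append)
  qed
  then show ?thesis using that by (auto simp: P_def)
qed

lemma state_replicate:
  "fst s \<noteq> l \<Longrightarrow> state (replicate k l) s = (if k = 0 then s else (l, snd l \<noteq> snd (fst s)))"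
  by (induction k) (auto simp: step_def)

lemma opposed_replicate:
  "fst s \<noteq> l \<Longrightarrow> opposed (replicate k l) s = (if snd l \<noteq> snd (fst s) then k else 0)"
  by (induction k) (auto simp: state_replicate step_def)

lemma isolated_replicate:
  "isolated y (replicate k l) s \<longleftrightarrow> k > 0 \<and> isolates y l s"
  if "fst s \<noteq> l" "fst l \<noteq> fst (fst s)"
  using that by (induction k) (auto simp: state_replicate isolates_def)

text \<open>The block \<open>(e, n)\<close> stands for \<open>x\<^sup>\<plusminus>\<^sup>1 y\<^sup>n\<close> with \<open>y = oth x\<close>; the argument \<open>e0\<close> of the functions below
  is the sign of the \<open>x\<close> that follows the last block.\<close>

type_synonym blocks = "(bool \<times> int) list"

definition ypow :: "gen \<Rightarrow> int \<Rightarrow> word" where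
  "ypow y n = replicate (nat \<bar>n\<bar>) (y, n > 0)"

lemma ypow_eq_Nil [simp]: "ypow y n = [] \<longleftrightarrow> n = 0" "ypow y 0 = []"
  by (auto simp: ypow_def)

fun word_of :: "gen \<Rightarrow> blocks \<Rightarrow> word" where
  "word_of x [] = []"
| "word_of x ((e, n) # es) = (x, e) # ypow (oth x) n @ word_of x es"

fun nx :: "blocks \<Rightarrow> bool \<Rightarrow> bool" where
  "nx [] e0 = e0"
| "nx ((e, n) # es) e0 = e"

text \<open>With exponent zero two letters \<open>x\<close> become adjacent, and only equal signs
  leave the word reduced.\<close>

fun sep_reduced :: "blocks \<Rightarrow> bool \<Rightarrow> bool" where
  "sep_reduced [] e0 \<longleftrightarrow> True"
| "sep_reduced ((e, n) # es) e0 \<longleftrightarrow> (n = 0 \<longrightarrow> e = nx es e0) \<and> sep_reduced es e0"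

text \<open>Whether the first letter of the word is opposed. Exponent zero prolongs its syllable
  into the next block, and \<open>f\<close> answers beyond the last one.\<close>

fun flag :: "blocks \<Rightarrow> bool \<Rightarrow> bool" where
  "flag [] f = f"
| "flag ((e, n) # es) f = (if n = 0 then flag es f else (n > 0) \<noteq> e)"

text \<open>Under the twist a positive \<open>x\<close> produces a \<open>y\<close> behind itself,
  and a negative one an inverse \<open>y\<close> in front of itself, which belongs to the preceding
  block. The change is half the sum of the two neighbouring signs.\<close>

fun shift :: "blocks \<Rightarrow> bool \<Rightarrow> blocks" where
  "shift [] e0 = []"
| "shift ((e, n) # es) e0 = (e, n + of_bool e - of_bool (\<not> nx es e0)) # shift es e0"

lemma hd_word_of: "hd (word_of x es @ [(x, e0)]) = (x, nx es e0)"
  by (cases es) auto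

lemma reduced_replicate: "reduced (replicate k l)"
  by (induction k) (auto simp: reduced_Cons hd_replicate)

lemma reduced_word_of: "reduced (word_of x es @ [(x, e0)]) \<longleftrightarrow> sep_reduced es e0"
proof (induction es)
  case (Cons p es)
  obtain e n where p: "p = (e, n)" by force
  let ?w = "word_of x es @ [(x, e0)]"
  have red: "reduced (ypow (oth x) n @ ?w) \<longleftrightarrow> reduced ?w"
    by (subst reduced_append) (auto simp: hd_word_of ypow_def reduced_replicate letter_inv_def)
  have hd: "hd (ypow (oth x) n @ ?w) = (if n = 0 then (x, nx es e0) else (oth x, n > 0))"
    using hd_word_of[of x es e0] by (cases "n = 0") (simp_all add: hd_append ypow_def)
  have split: "word_of x (p # es) @ [(x, e0)] = (x, e) # (ypow (oth x) n @ ?w)"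
    by (simp add: p)
  show ?case unfolding split reduced_Cons red hd Cons by (auto simp: p letter_inv_def)
qed simp

lemma state_word_of:
  "sep_reduced es e0 \<Longrightarrow> state (word_of x es) ((x, e0), f) = ((x, nx es e0), flag es f)"
  by (induction es rule: word_of.induct) (auto simp: ypow_def state_replicate step_def)

lemma opposed_word_of_Cons:
  assumes "sep_reduced ((e, n) # es) e0"
  shows "opposed (word_of x ((e, n) # es)) ((x, e0), f) = of_bool (flag ((e, n) # es) f) +
    (if n \<noteq> 0 \<and> (n > 0) \<noteq> nx es e0 then nat \<bar>n\<bar> else 0) + opposed (word_of x es) ((x, e0), f)"
  using assms
  by (auto simp: ypow_def opposed_append opposed_replicate state_replicate state_word_of step_def)

lemma isolated_word_of_Cons:
  assumes "sep_reduced ((e, n) # es) e0"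
  shows "isolated (oth x) (word_of x ((e, n) # es)) ((x, e0), f) \<longleftrightarrow>
      n \<noteq> 0 \<and> (n > 0) \<noteq> e \<and> (n > 0) \<noteq> nx es e0 \<or> isolated (oth x) (word_of x es) ((x, e0), f)"
    and "isolated x (word_of x ((e, n) # es)) ((x, e0), f) \<longleftrightarrow>
      n \<noteq> 0 \<and> (n > 0) \<noteq> nx es e0 \<and> flag es f \<or> isolated x (word_of x es) ((x, e0), f)"
  using assms
  by (auto simp: ypow_def isolated_append isolated_replicate isolates_def state_replicate state_word_of)

lemma nx_shift [simp]: "nx (shift es e0) e1 = nx es e1"
  by (cases es) auto

lemma map_fst_shift: "map fst (shift es e0) = map fst es"
  by (induction es e0 rule: shift.induct) auto

lemma sep_reduced_shift: "sep_reduced es e0 \<Longrightarrow> sep_reduced (shift es e0) e0"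
  by (induction es e0 rule: shift.induct) auto

lemma flag_shift: "sep_reduced es e0 \<Longrightarrow> f' \<le> f \<Longrightarrow> flag (shift es e0) f' \<le> flag es f"
  by (induction es e0 rule: shift.induct) (auto split: if_splits)

text \<open>The comparison is made block by block. An exponent between equal signs moves by one
  towards their sign, any other stays. So a power opposed to the next \<open>x\<close> never grows,
  and an isolated power shrinks.\<close>

lemma shift_word_of:
  fixes x :: gen and es :: blocks
  assumes "sep_reduced es e0" "f' \<le> f"
  defines "s \<equiv> ((x, e0), f)" and "s' \<equiv> ((x, e0), f')"
    and "w \<equiv> word_of x es" and "w' \<equiv> word_of x (shift es e0)"
  shows "opposed w' s' \<le> opposed w s"
    and "isolated (oth x) w s \<Longrightarrow> opposed w' s' < opposed w s"
    and "isolated (oth x) w' s' \<Longrightarrow> isolated (oth x) w s"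
    and "isolated x w' s' \<Longrightarrow> isolated x w s"
proof -
  have "opposed w' s' \<le> opposed w s \<and>
    (isolated (oth x) w s \<longrightarrow> opposed w' s' < opposed w s) \<and>
    (isolated (oth x) w' s' \<longrightarrow> isolated (oth x) w s) \<and>
    (isolated x w' s' \<longrightarrow> isolated x w s)"
    using assms(1) unfolding s_def s'_def w_def w'_def
  proof (induction es)
    case (Cons p es)
    obtain e n where p: "p = (e, n)" by force
    have red: "sep_reduced es e0" "n = 0 \<Longrightarrow> e = nx es e0" using Cons.prems p by auto
    note IH = Cons.IH[OF red(1)]
    define e' where "e' = nx es e0"
    define n' where "n' = n + of_bool e - of_bool (\<not> e')"
    have shift: "shift (p # es) e0 = (e, n') # shift es e0" by (simp add: p n'_def e'_def)
    have red': "sep_reduced ((e, n') # shift es e0) e0"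
      using sep_reduced_shift[OF Cons.prems] shift by simp
    have fl: "flag ((e, n') # shift es e0) f' \<le> flag ((e, n) # es) f"
      using flag_shift[OF Cons.prems assms(2)] unfolding shift unfolding p .
    have fl': "flag (shift es e0) f' \<le> flag es f" by (rule flag_shift[OF red(1) assms(2)])
    have le: "(if n' \<noteq> 0 \<and> (n' > 0) \<noteq> e' then nat \<bar>n'\<bar> else 0)
      \<le> (if n \<noteq> 0 \<and> (n > 0) \<noteq> e' then nat \<bar>n\<bar> else 0)"
      by (cases e; cases e') (auto simp: n'_def)
    have less: "(if n' \<noteq> 0 \<and> (n' > 0) \<noteq> e' then nat \<bar>n'\<bar> else 0)
      < (if n \<noteq> 0 \<and> (n > 0) \<noteq> e' then nat \<bar>n\<bar> else 0)" if "n \<noteq> 0 \<and> (n > 0) \<noteq> e \<and> (n > 0) \<noteq> e'"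
      using that by (cases e; cases e') (auto simp: n'_def)
    have fl2: "of_bool (flag ((e, n') # shift es e0) f') \<le> (of_bool (flag ((e, n) # es) f) :: nat)"
      using fl by (auto simp: le_bool_def)
    have iso: "n' \<noteq> 0 \<and> (n' > 0) \<noteq> e \<and> (n' > 0) \<noteq> e' \<Longrightarrow> n \<noteq> 0 \<and> (n > 0) \<noteq> e \<and> (n > 0) \<noteq> e'"
      "n' \<noteq> 0 \<and> (n' > 0) \<noteq> e' \<Longrightarrow> n \<noteq> 0 \<and> (n > 0) \<noteq> e'"
      by (cases e; cases e'; auto simp: n'_def)+
    show ?case
      unfolding shift unfolding p opposed_word_of_Cons[OF Cons.prems[unfolded p]]
        opposed_word_of_Cons[OF red'] isolated_word_of_Cons[OF Cons.prems[unfolded p]]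
        isolated_word_of_Cons[OF red'] nx_shift e'_def[symmetric]
    proof (intro conjI impI, goal_cases)
      case 1
      show ?case using IH by (intro add_mono fl2 le) blast
    next
      case 2
      then show ?case
      proof
        assume "n \<noteq> 0 \<and> (n > 0) \<noteq> e \<and> (n > 0) \<noteq> e'"
        from less[OF this] show ?thesis
          using IH by (intro add_less_le_mono add_le_less_mono fl2) blast+
      next
        assume "isolated (oth x) (word_of x es) ((x, e0), f)"
        then show ?thesis using IH by (intro add_le_less_mono add_mono fl2 le) blast
      qed
    next
      case 3
      then show ?case using IH iso(1) by blast
    next
      case 4
      then show ?case using IH iso(2) fl'[unfolded le_bool_def] by blast
    qed
  qed simp
  then show "opposed w' s' \<le> opposed w s"
    "isolated (oth x) w s \<Longrightarrow> opposed w' s' < opposed w s"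
    "isolated (oth x) w' s' \<Longrightarrow> isolated (oth x) w s"
    "isolated x w' s' \<Longrightarrow> isolated x w s" by auto
qed

section \<open>The effect of a twist\<close>

lemma set_ypow: "set (ypow y n) = (if n = 0 then {} else {(y, n > 0)})"
  by (simp add: ypow_def)

lemma uniform_word_of_sep: "uniform x (word_of x es) \<longleftrightarrow> (\<exists>e. \<forall>e'\<in>set (map fst es). e' = e)"
proof -
  have "(\<forall>l\<in>set (word_of x es). fst l = x \<longrightarrow> snd l = e) \<longleftrightarrow> (\<forall>e'\<in>set (map fst es). e' = e)" for e
    by (induction x es rule: word_of.induct) (simp_all add: set_ypow ball_Un)
  then show ?thesis by (simp add: uniform_def)
qed

lemma uniform_word_of_oth:
  "uniform (oth x) (word_of x es) \<longleftrightarrow> (\<exists>b. \<forall>n\<in>set (map snd es). n \<noteq> 0 \<longrightarrow> (n > 0) = b)"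
proof -
  have "(\<forall>l\<in>set (word_of x es). fst l = oth x \<longrightarrow> snd l = b) \<longleftrightarrow>
    (\<forall>n\<in>set (map snd es). n \<noteq> 0 \<longrightarrow> (n > 0) = b)" for b
    by (induction x es rule: word_of.induct) (simp_all add: set_ypow ball_Un)
  then show ?thesis by (simp add: uniform_def)
qed

text \<open>Without isolated powers of \<open>y\<close>, an exponent between equal signs is zero or
  already has their sign, so the shift moves it away from zero; all other exponents stay.\<close>

lemma uniform_shift_oth:
  assumes "sep_reduced es e0" "\<not> isolated (oth x) (word_of x es) ((x, e0), f)"
    and "uniform (oth x) (word_of x (shift es e0))"
  shows "uniform (oth x) (word_of x es)"
proof -
  obtain b where b: "\<forall>n\<in>set (map snd (shift es e0)). n \<noteq> 0 \<longrightarrow> (n > 0) = b"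
    using assms(3) by (auto simp: uniform_word_of_oth)
  have "\<forall>n\<in>set (map snd es). n \<noteq> 0 \<longrightarrow> (n > 0) = b"
    using assms(1,2) b
  proof (induction es)
    case (Cons p es)
    obtain e n where p: "p = (e, n)" by force
    have iso: "\<not> (n \<noteq> 0 \<and> (n > 0) \<noteq> e \<and> (n > 0) \<noteq> nx es e0)"
      and IH: "\<forall>n\<in>set (map snd es). n \<noteq> 0 \<longrightarrow> (n > 0) = b"
      using Cons p isolated_word_of_Cons(1)[of e n es e0 x f] by auto
    have "n + of_bool e - of_bool (\<not> nx es e0) \<noteq> 0 \<longrightarrow>
      (n + of_bool e - of_bool (\<not> nx es e0) > 0) = b"
      using Cons.prems(3) p by simp
    then have "n \<noteq> 0 \<longrightarrow> (n > 0) = b"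
      using iso by (cases e; cases "nx es e0"; cases b) auto
    then show ?case using IH p by simp
  qed simp
  then show ?thesis by (auto simp: uniform_word_of_oth)
qed

lemma ypow_step:
  "grp (ypow y (n + 1)) = gl y + grp (ypow y n)" "grp (ypow y (n + 1)) = grp (ypow y n) + gl y"
proof -
  have "grp (ypow y (n + 1)) = gl y + grp (ypow y n) \<and> grp (ypow y (n + 1)) = grp (ypow y n) + gl y"
  proof (cases "n \<ge> 0")
    case True
    then have "nat \<bar>n + 1\<bar> = Suc (nat \<bar>n\<bar>)" by simp
    then have "ypow y (n + 1) = [(y, True)] @ replicate (nat \<bar>n\<bar>) (y, True)"
      "ypow y (n + 1) = replicate (nat \<bar>n\<bar>) (y, True) @ [(y, True)]"
      using True by (simp_all add: ypow_def replicate_append_same)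
    moreover have "ypow y n = replicate (nat \<bar>n\<bar>) (y, True)"
      using True by (cases "n = 0") (simp_all add: ypow_def)
    ultimately show ?thesis by (metis gl_def grp_append)
  next
    case False
    then have "nat \<bar>n\<bar> = Suc (nat \<bar>n + 1\<bar>)" by simp
    then have "ypow y n = [(y, False)] @ replicate (nat \<bar>n + 1\<bar>) (y, False)"
      "ypow y n = replicate (nat \<bar>n + 1\<bar>) (y, False) @ [(y, False)]"
      using False by (simp_all add: ypow_def replicate_append_same)
    moreover have "ypow y (n + 1) = replicate (nat \<bar>n + 1\<bar>) (y, False)"
      using False by (cases "n + 1 = 0") (simp_all add: ypow_def)
    ultimately have "grp (ypow y n) = - gl y + grp (ypow y (n + 1))"
      "grp (ypow y n) = grp (ypow y (n + 1)) + - gl y"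
      by (metis grp_append grp_False)+
    then show ?thesis by (metis add.assoc add.right_neutral left_minus add_minus_cancel)
  qed
  then show "grp (ypow y (n + 1)) = gl y + grp (ypow y n)"
    "grp (ypow y (n + 1)) = grp (ypow y n) + gl y" by auto
qed

lemma ypow_pred: "grp (ypow y (n - 1)) = grp (ypow y n) - gl y"
  using ypow_step(2)[of y "n - 1"] by simp

lemma twist_ypow: "twist x (grp (ypow (oth x) n)) = grp (ypow (oth x) n)"
proof -
  have "twist x (grp (replicate k (oth x, b))) = grp (replicate k (oth x, b))" for k b
  proof (induction k)
    case (Suc k)
    have "grp (replicate (Suc k) l) = grp [l] + grp (replicate k l)" for l
      using grp_append[of "[l]" "replicate k l"] by simp
    then show ?case using Suc by (cases b) (simp_all add: grp_False flip: gl_def)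
  qed simp
  then show ?thesis by (simp add: ypow_def)
qed

text \<open>\<open>twist x\<close> sends \<open>-x\<close> to \<open>-y - x\<close>. The leading \<open>-y\<close> of such a block is moved to the block before it.\<close>

definition cpart :: "gen \<Rightarrow> bool \<Rightarrow> free2" where
  "cpart x e = (if e then 0 else - gl (oth x))"

text \<open>The corrections telescope, since each block hands over what its predecessor receives.
  Only those at the two ends remain, and for a cyclic word they amount to a conjugation.\<close>

lemma twist_word_of:
  "grp (word_of x (shift es e0)) = - cpart x (nx es e0) + twist x (grp (word_of x es)) + cpart x e0"
proof (induction es)
  case (Cons p es)
  obtain e n where p: "p = (e, n)" by force
  let ?y = "oth x"
  define e' where "e' = nx es e0"
  have l: "grp [(x, e)] = (if e then gl x else - gl x)" by (simp add: grp_False gl_def)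
  have w: "grp (word_of x ((e, n) # es)) = grp [(x, e)] + grp (ypow ?y n) + grp (word_of x es)" for n es
    using grp_append[of "[(x, e)]" "ypow ?y n @ word_of x es"]
    by (simp add: grp_append[of "ypow ?y n"] add.assoc)
  have block: "grp [(x, e)] + grp (ypow ?y (n + of_bool e - of_bool (\<not> e'))) =
    - cpart x e + twist x (grp [(x, e)] + grp (ypow ?y n)) + cpart x e'"
    unfolding l by (cases e; cases e')
      (simp_all add: cpart_def ypow_step ypow_pred[unfolded diff_conv_add_uminus] twist_ypow
          group_add_norm del: add_uminus_conv_diff
        flip: ypow_step(1))
  show ?case
    by (simp only: p shift.simps w nx.simps e'_def[symmetric] block Cons twist_add)
       (simp add: e'_def[symmetric] group_add_norm del: add_uminus_conv_diff)
qed (simp add: cpart_def)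

lemma ex_word_of:
  assumes "reduced w"
  shows "\<exists>n es. w = ypow (oth x) n @ word_of x es"
  using assms
proof (induction w)
  case Nil
  show ?case by (intro exI[of _ 0] exI[of _ "[]"]) simp
next
  case (Cons l w)
  then obtain n es where w: "w = ypow (oth x) n @ word_of x es" by (auto simp: reduced_Cons)
  obtain g b where l: "l = (g, b)" by force
  show ?case
  proof (cases "g = x")
    case True
    then show ?thesis using w l by (intro exI[of _ 0] exI[of _ "(b, n) # es"]) simp
  next
    case False
    then have g: "g = oth x" by (simp add: neq_oth)
    have b: "n \<noteq> 0 \<Longrightarrow> (n > 0) = b"
      using Cons.prems w l g by (cases "nat \<bar>n\<bar>") (auto simp: reduced_Cons ypow_def letter_inv_def)
    define n' where "n' = (if b then n + 1 else n - 1)"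
    have "nat \<bar>n'\<bar> = Suc (nat \<bar>n\<bar>)" "(n' > 0) = b"
      using b by (cases b; cases "n = 0"; auto simp: n'_def)+
    then have "ypow (oth x) n' = l # ypow (oth x) n"
      using b l g by (cases "n = 0") (simp_all add: ypow_def)
    then show ?thesis using w by (intro exI[of _ n'] exI[of _ es]) simp
  qed
qed

text \<open>Rotating until the word starts with \<open>x\<close> makes the leading power in
  \<open>ex_word_of\<close> trivial.\<close>

lemma rotate_to_blocks:
  assumes "cyclically_reduced w" "x \<in> fst ` set w"
  obtains n e m es where "rotate n w = word_of x ((e, m) # es)"
proof -
  obtain u l v where w: "w = u @ l # v" "fst l = x" using assms by (metis imageE split_list)
  then have r: "rotate (length u) w = l # v @ u" by (simp add: rotate_append)
  then have "reduced (l # v @ u)"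
    using assms cyclically_reduced_rotate cyclically_reduced_def by metis
  then obtain n es where *: "l # v @ u = ypow (oth x) n @ word_of x es" using ex_word_of by blast
  have "n = 0"
  proof (rule ccontr)
    assume "n \<noteq> 0"
    then show False using * w(2) by (cases "nat \<bar>n\<bar>") (auto simp: ypow_def)
  qed
  then have "rotate (length u) w = word_of x es" "es \<noteq> []" using * r by auto
  then show ?thesis using that by (cases es) auto
qed

lemma cyclically_reduced_word_of:
  "cyclically_reduced (word_of x ((e, m) # es)) \<longleftrightarrow> sep_reduced ((e, m) # es) e"
  by (simp only: reduced_word_of[of x, symmetric] cyclically_reduced_iff) simp

lemma uniform_rotate [simp]: "uniform y (rotate n w) = uniform y w"
  by (simp add: uniform_def)

lemma twist_blocks:
  fixes x :: gen
  defines "w es \<equiv> word_of x es"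
  assumes "es = (e, m) # es'" "cyclically_reduced (w es)" "state (w es) s = s"
  shows "\<exists>v s'. cyclically_reduced v \<and> twist x (grp (w es)) \<sim> grp v \<and> state v s' = s' \<and>
    opposed v s' \<le> opposed (w es) s \<and> (isolated (oth x) (w es) s \<longrightarrow> opposed v s' < opposed (w es) s) \<and>
    (\<forall>y. isolated y v s' \<longrightarrow> isolated y (w es) s) \<and> (uniform x v \<longleftrightarrow> uniform x (w es)) \<and>
    (\<not> isolated (oth x) (w es) s \<longrightarrow> uniform (oth x) v \<longrightarrow> uniform (oth x) (w es))"
proof -
  have red: "sep_reduced es e"
    using assms(3) cyclically_reduced_word_of[of x e m es'] by (simp only: w_def assms(2))
  have "fst s = fst (state (w es) s)" using assms(4) by simp
  also have "\<dots> = (x, e)" by (simp add: w_def assms(2) step_def)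
  finally have "fst s = (x, e)" .
  then obtain f where s: "s = ((x, e), f)" by (cases s) auto
  have nx: "nx es e = e" by (simp add: assms)
  have f: "flag es f = f" using assms(4) state_word_of[OF red, of x f] by (simp add: s w_def)
  let ?es = "shift es e"
  have red': "sep_reduced ?es e" by (rule sep_reduced_shift[OF red])
  \<comment> \<open>As a function of its last argument \<open>flag\<close> is constant or the
    identity, so one application to \<open>False\<close> reaches a fixed point; starting from
    \<open>False\<close> keeps it below \<open>f\<close>.\<close>
  define f' where "f' = flag ?es False"
  have f'_le: "f' \<le> f" using flag_shift[OF red, of False f] f by (simp add: f'_def)
  have idem: "flag fs (flag fs False) = flag fs False" for fs
  proof (cases "\<forall>g. flag fs g = g")
    case False
    have "flag fs True = flag fs False \<or> (\<forall>g. flag fs g = g)"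
      by (induction fs rule: word_of.induct) auto
    then show ?thesis using False by (metis (full_types))
  qed auto
  define s' where "s' = ((x, e), f')"
  have fix': "state (w ?es) s' = s'"
    using state_word_of[OF red', of x f'] idem nx by (simp add: s'_def w_def f'_def)
  have cyc': "cyclically_reduced (w ?es)"
    using cyclically_reduced_word_of[of x] red' by (simp add: w_def assms(2))
  have "grp (w ?es) = - cpart x e + twist x (grp (w es)) + cpart x e"
    unfolding w_def twist_word_of nx ..
  then have "twist x (grp (w es)) \<sim> grp (w ?es)"
    unfolding conj2_def by (intro exI[of _ "- cpart x e"]) (simp del: add_uminus_conv_diff add: diff_conv_add_uminus)
  moreover have "isolated y (w ?es) s' \<longrightarrow> isolated y (w es) s" for y
    using shift_word_of(3,4)[OF red f'_le, of x] unfolding s s'_def w_def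
    by (cases "y = x") (auto simp: neq_oth)
  moreover have "uniform x (w ?es) \<longleftrightarrow> uniform x (w es)"
    by (simp only: w_def uniform_word_of_sep map_fst_shift)
  moreover have "\<not> isolated (oth x) (w es) s \<longrightarrow> uniform (oth x) (w ?es) \<longrightarrow> uniform (oth x) (w es)"
    using uniform_shift_oth[OF red] unfolding s w_def by blast
  moreover have "opposed (w ?es) s' \<le> opposed (w es) s"
    "isolated (oth x) (w es) s \<longrightarrow> opposed (w ?es) s' < opposed (w es) s"
    using shift_word_of(1,2)[OF red f'_le, of x] unfolding s s'_def w_def by auto
  ultimately show ?thesis using fix' cyc' by blast
qed

lemma isolated_imp_mem: "isolated y w s \<Longrightarrow> oth y \<in> fst ` set w"
  by (induction w) (auto simp: isolates_def neq_oth)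

lemma twist_no_letter: "x \<notin> fst ` set w \<Longrightarrow> twist x (grp w) = grp w"
proof (induction w)
  case (Cons l w)
  obtain b where "l = (oth x, b)" using Cons.prems by (cases l) (auto simp: neq_oth)
  then have "twist x (grp [l]) = grp [l]" by (cases b) (simp_all add: grp_False flip: gl_def)
  then show ?case using Cons by (simp add: grp_Cons[of l w])
qed simp

text \<open>If \<open>x\<close> occurs, rotation into block form reduces this to
  \<open>twist_blocks\<close>; otherwise the twist fixes the word and no power of the other
  generator is isolated.\<close>

theorem twist_step:
  assumes "cyclically_reduced w" "state w s = s"
  obtains v s' where "cyclically_reduced v" "twist x (grp w) \<sim> grp v" "state v s' = s'"
    "opposed v s' \<le> opposed w s" "isolated (oth x) w s \<Longrightarrow> opposed v s' < opposed w s"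
    "\<And>y. isolated y v s' \<Longrightarrow> isolated y w s" "uniform x v \<longleftrightarrow> uniform x w"
    "\<not> isolated (oth x) w s \<Longrightarrow> uniform (oth x) v \<Longrightarrow> uniform (oth x) w"
proof (cases "x \<in> fst ` set w")
  case True
  then obtain n e m es where r: "rotate n w = word_of x ((e, m) # es)"
    using rotate_to_blocks assms by metis
  let ?es = "(e, m) # es"
  obtain t where t: "state (rotate n w) t = t" "opposed (rotate n w) t = opposed w s"
    "\<And>y. isolated y (rotate n w) t = isolated y w s" using rotate_state assms(2) by blast
  have "cyclically_reduced (word_of x ?es)" using assms r cyclically_reduced_rotate by metis
  from twist_blocks[OF HOL.refl this t(1)[unfolded r]] obtain v s' where
    v: "cyclically_reduced v" "twist x (grp (rotate n w)) \<sim> grp v" "state v s' = s'"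
    "opposed v s' \<le> opposed w s" "isolated (oth x) w s \<longrightarrow> opposed v s' < opposed w s"
    "\<forall>y. isolated y v s' \<longrightarrow> isolated y w s" "uniform x v \<longleftrightarrow> uniform x w"
    "\<not> isolated (oth x) w s \<longrightarrow> uniform (oth x) v \<longrightarrow> uniform (oth x) w"
    unfolding r[symmetric] t uniform_rotate by blast
  have "twist x (grp w) \<sim> grp v"
    using conj2_additive[OF additive_twist conj2_rotate] v(2) conj2_trans by blast
  then show ?thesis using that v by blast
next
  case False
  then have "\<not> isolated (oth x) w s" using isolated_imp_mem[of "oth x" w s] unfolding oth_oth by blast
  then show ?thesis using that[of w s] assms False twist_no_letter by auto
qed

section \<open>Shortening chains\<close>

definition one_signed_word :: "word \<Rightarrow> bool" where
  "one_signed_word w \<longleftrightarrow> (\<exists>e. \<forall>l\<in>set w. snd l = e)"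

definition one_signed :: "free2 \<Rightarrow> bool" where
  "one_signed g \<longleftrightarrow> (\<exists>v. one_signed_word v \<and> g \<sim> grp v)"

lemma one_signed_conj: "g \<sim> h \<Longrightarrow> one_signed g \<longleftrightarrow> one_signed h"
  unfolding one_signed_def using conj2_sym conj2_trans by blast

lemma reduced_one_signed: "\<forall>l\<in>set w. snd l = e \<Longrightarrow> reduced w"
proof (induction w)
  case (Cons l w)
  then show ?case by (cases w) (auto simp: reduced_Cons letter_inv_def)
qed simp

lemma cyclically_reduced_one_signed: "one_signed_word w \<Longrightarrow> cyclically_reduced w"
proof -
  assume "one_signed_word w"
  then obtain e where e: "\<forall>l\<in>set w. snd l = e" by (auto simp: one_signed_word_def)
  show ?thesis
  proof (cases "w = []")
    case False
    then have "\<forall>l\<in>set (w @ [hd w]). snd l = e" using e by simp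
    then show ?thesis using reduced_one_signed by (auto simp only: cyclically_reduced_iff)
  qed (simp add: cyclically_reduced_iff)
qed

lemma one_signed_grp_iff:
  assumes "cyclically_reduced w"
  shows "one_signed (grp w) \<longleftrightarrow> one_signed_word w"
proof
  assume "one_signed (grp w)"
  then obtain v where v: "one_signed_word v" "grp w \<sim> grp v" by (auto simp: one_signed_def)
  then obtain n where "v = rotate n w"
    using cyclically_reduced_conjugate assms cyclically_reduced_one_signed by blast
  then show "one_signed_word w" using v by (simp add: one_signed_word_def)
qed (use conj2_refl in \<open>auto simp: one_signed_def\<close>)

text \<open>Reading a nonempty word fixes the letter of the state and acts on the flag by a monotone
  map, whose value at \<open>False\<close> is a fixed point.\<close>

lemma ex_fixed_state: "\<exists>s. state w s = s"
proof (cases "w = []")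
  case False
  have *: "fst (state v (z, True)) = fst (state v (z, False)) \<and>
    (snd (state v (z, True)) = snd (state v (z, False)) \<or>
      snd (state v (z, True)) \<and> \<not> snd (state v (z, False)))" for v z
    by (induction v) (auto simp: step_def)
  define g where "g f = snd (state w (hd w, f))" for f
  have "fst (state w s) = hd w" for s using False by (cases w) (simp_all add: step_def)
  then have st: "state w (hd w, f) = (hd w, g f)" for f by (simp add: g_def prod_eq_iff)
  have "g True = g False \<or> g True \<and> \<not> g False"
    using *[of w "hd w"] by (simp add: g_def)
  then have "g (g False) = g False" by (cases "g False") simp_all
  then show ?thesis using st by (intro exI[of _ "(hd w, g False)"]) simp
qed simp

lemma one_signed_single_gen:
  "reduced w \<Longrightarrow> \<forall>l\<in>set w. fst l = y \<Longrightarrow> one_signed_word w"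
proof (induction w)
  case (Cons l w)
  then obtain e where e: "\<forall>l\<in>set w. snd l = e"
    by (auto simp: reduced_Cons one_signed_word_def)
  show ?case
  proof (cases w)
    case (Cons l' w')
    then have "snd l' = e" "fst l' = fst l" "l' \<noteq> letter_inv l"
      using Cons.prems e \<open>w = l' # w'\<close> by (auto simp: reduced_Cons)
    then have "snd l = e" by (cases l; cases l') (auto simp: letter_inv_def)
    then show ?thesis using e unfolding one_signed_word_def by auto
  qed (auto simp: one_signed_word_def)
qed (simp add: one_signed_word_def)

lemma isolated_if_uniform_blocks:
  assumes "sep_reduced es e0" "\<forall>e\<in>set (map fst es). e = e0"
    and "\<exists>n\<in>set (map snd es). n \<noteq> 0 \<and> (n > 0) \<noteq> e0"
  shows "isolated (oth x) (word_of x es) ((x, e0), f)"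
  using assms
proof (induction es)
  case (Cons p es)
  obtain e n where p: "p = (e, n)" by force
  have e: "e = e0" "nx es e0 = e0" using Cons.prems(2) p by (simp, cases es) auto
  show ?case
    unfolding p isolated_word_of_Cons(1)[OF Cons.prems(1)[unfolded p]]
  proof (cases "n \<noteq> 0 \<and> (n > 0) \<noteq> e0")
    case False
    then have "\<exists>n\<in>set (map snd es). n \<noteq> 0 \<and> (n > 0) \<noteq> e0"
      using Cons.prems(3) unfolding p list.map set_simps snd_conv by blast
    then have "isolated (oth x) (word_of x es) ((x, e0), f)"
      using Cons.IH Cons.prems(1,2) unfolding p by simp
    then show "n \<noteq> 0 \<and> (n > 0) \<noteq> e \<and> (n > 0) \<noteq> nx es e0 \<or>
      isolated (oth x) (word_of x es) ((x, e0), f)" ..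
  qed (simp add: e)
qed simp

text \<open>Some power of the other generator has the sign opposite to the common sign of all
  \<open>x\<close>, and its neighbours are letters \<open>x\<close>. If there is no
  \<open>x\<close>, the word is a power of one generator and hence one-signed.\<close>

lemma isolated_if_uniform:
  assumes "cyclically_reduced w" "state w s = s" "uniform x w" "\<not> one_signed_word w"
  shows "isolated (oth x) w s"
proof (cases "x \<in> fst ` set w")
  case True
  then obtain n e m es where r: "rotate n w = word_of x ((e, m) # es)"
    using rotate_to_blocks assms by metis
  let ?es = "(e, m) # es"
  obtain t where t: "state (rotate n w) t = t" "\<And>y. isolated y (rotate n w) t = isolated y w s"
    using rotate_state assms(2) by blast
  have "fst t = fst (state (word_of x ?es) t)" using t(1) unfolding r by simp
  also have "\<dots> = (x, e)" by (simp add: step_def)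
  finally obtain f where f: "t = ((x, e), f)" by (cases t) auto
  have "cyclically_reduced (word_of x ?es)" using assms r cyclically_reduced_rotate by metis
  then have red: "sep_reduced ?es e" by (simp only: cyclically_reduced_word_of)
  have "uniform x (word_of x ?es)" using assms(3) by (simp only: r[symmetric] uniform_rotate)
  then have e: "\<forall>e'\<in>set (map fst ?es). e' = e" unfolding uniform_word_of_sep by simp
  have "\<exists>n\<in>set (map snd ?es). n \<noteq> 0 \<and> (n > 0) \<noteq> e"
  proof (rule ccontr)
    assume *: "\<not> ?thesis"
    have "\<forall>l\<in>set (word_of x fs). snd l = e"
      if "\<forall>e'\<in>set (map fst fs). e' = e" "\<not> (\<exists>n\<in>set (map snd fs). n \<noteq> 0 \<and> (n > 0) \<noteq> e)" for fs
      using that by (induction x fs rule: word_of.induct) (simp_all add: set_ypow ball_Un, blast)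
    from this[OF e *] have "one_signed_word (rotate n w)"
      unfolding r one_signed_word_def by blast
    then show False using assms(4) by (simp add: one_signed_word_def)
  qed
  then show ?thesis using isolated_if_uniform_blocks[OF red e] t(2) unfolding r f by blast
next
  case False
  have "fst l = oth x" if "l \<in> set w" for l
    unfolding neq_oth[symmetric] using False that by blast
  then show ?thesis using one_signed_single_gen assms cyclically_reduced_def by blast
qed

fun twists :: "gen list \<Rightarrow> free2 \<Rightarrow> free2" where
  "twists [] g = g"
| "twists (x # xs) g = twists xs (twist x g)"

lemma additive_twists: "additive (twists xs)"
proof (induction xs)
  case (Cons x xs)
  then show ?case by (simp add: additive_def)
qed (simp add: additive_def)

lemma twists_conj: "g \<sim> h \<Longrightarrow> twists xs g \<sim> twists xs h"
  by (rule conj2_additive[OF additive_twists])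

text \<open>Absence of isolated syllables persists along the chain, and uniformity, which holds at
  its end, is pulled back through each twist.\<close>

lemma uniform_if_no_isolated:
  assumes "cyclically_reduced w" "state w s = s" "one_signed (twists xs (grp w))" "\<not> isolated y w s"
  shows "uniform y w"
  using assms
proof (induction xs arbitrary: w s)
  case Nil
  then have "one_signed_word w" by (simp add: one_signed_grp_iff)
  then show ?case by (auto simp: one_signed_word_def uniform_def)
next
  case (Cons x xs)
  obtain v s' where v: "cyclically_reduced v" "twist x (grp w) \<sim> grp v" "state v s' = s'"
    "\<And>y. isolated y v s' \<Longrightarrow> isolated y w s" "uniform x v \<longleftrightarrow> uniform x w"
    "\<not> isolated (oth x) w s \<Longrightarrow> uniform (oth x) v \<Longrightarrow> uniform (oth x) w"
    using twist_step[OF Cons.prems(1,2), of x] by metis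
  have "one_signed (twists xs (grp v))"
    using Cons.prems(3) one_signed_conj[OF twists_conj[OF v(2)]] by simp
  then have "uniform y v" using Cons.IH v Cons.prems(4) by blast
  then show ?case using v(5,6) Cons.prems(4) neq_oth by metis
qed

text \<open>As long as the word is not one-signed, \<open>isolated_if_uniform\<close> supplies an
  isolated syllable, so the next twist lowers the number of opposed letters and keeps
  \<open>x\<close> uniform.\<close>

lemma twist_power_one_signed:
  assumes "cyclically_reduced w" "state w s = s" "uniform x w"
  shows "\<exists>k\<le>opposed w s. one_signed (twists (replicate k x) (grp w))"
  using assms
proof (induction "opposed w s" arbitrary: w s rule: less_induct)
  case less
  show ?case
  proof (cases "one_signed_word w")
    case True
    then show ?thesis using less by (intro exI[of _ 0]) (simp add: one_signed_grp_iff)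
  next
    case False
    then have "isolated (oth x) w s" using isolated_if_uniform less by blast
    then obtain v s' where v: "cyclically_reduced v" "twist x (grp w) \<sim> grp v" "state v s' = s'"
      "opposed v s' < opposed w s" "uniform x v"
      using twist_step[OF less.prems(1,2), of x] less.prems(3) by metis
    then obtain k where k: "k \<le> opposed v s'" "one_signed (twists (replicate k x) (grp v))"
      using less.hyps by blast
    then have "one_signed (twists (replicate (Suc k) x) (grp w))"
      using one_signed_conj[OF twists_conj[OF v(2)]] by simp
    then show ?thesis using k v(4) by (intro exI[of _ "Suc k"]) simp
  qed
qed

text \<open>A twist of the given chain is kept if it lowers the number of opposed letters. At the
  first one with no isolated syllable to shorten, the rest is replaced by a power of the other
  twist.\<close>

lemma shorten_twists_aux:
  assumes "cyclically_reduced w" "state w s = s" "one_signed (twists xs (grp w))"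
  shows "\<exists>zs. length zs \<le> opposed w s \<and> one_signed (twists zs (grp w))"
  using assms
proof (induction xs arbitrary: w s)
  case Nil
  then show ?case by (intro exI[of _ "[]"]) simp
next
  case (Cons x xs)
  show ?case
  proof (cases "isolated (oth x) w s")
    case True
    then obtain v s' where v: "cyclically_reduced v" "twist x (grp w) \<sim> grp v" "state v s' = s'"
      "opposed v s' < opposed w s"
      using twist_step[OF Cons.prems(1,2), of x] by metis
    then have "one_signed (twists xs (grp v))"
      using Cons.prems(3) one_signed_conj[OF twists_conj[OF v(2)]] by simp
    then obtain zs where zs: "length zs \<le> opposed v s'" "one_signed (twists zs (grp v))"
      using Cons.IH v by blast
    then have "one_signed (twists (x # zs) (grp w))"
      using one_signed_conj[OF twists_conj[OF v(2)]] by simp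
    then show ?thesis using zs v(4) by (intro exI[of _ "x # zs"]) simp
  next
    case False
    then have "uniform (oth x) w" using uniform_if_no_isolated Cons.prems by blast
    then show ?thesis
      using twist_power_one_signed[OF Cons.prems(1,2)] by (metis length_replicate)
  qed
qed

theorem shorten_twists:
  assumes "cyclically_reduced w" "g \<sim> grp w" "one_signed (twists xs g)"
  obtains zs where "length zs \<le> length w" "one_signed (twists zs g)"
proof -
  obtain s where "state w s = s" using ex_fixed_state by blast
  moreover have "one_signed (twists xs (grp w))"
    using assms one_signed_conj twists_conj by blast
  ultimately obtain zs where "length zs \<le> opposed w s" "one_signed (twists zs (grp w))"
    using shorten_twists_aux assms by blast
  then show ?thesis
    using that opposed_le_length[of w s] one_signed_conj[OF twists_conj[OF assms(2)]] by force
qed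

section \<open>Inverse twists and symmetries of the basis\<close>

fun untwist :: "gen \<Rightarrow> free2 \<Rightarrow> free2" where
  "untwist GenA = sub (genA - genB) genB"
| "untwist GenB = sub genA (genB - genA)"

lemma additive_untwist: "additive (untwist x)"
  by (cases x) (simp_all add: additive_sub)

lemma twist_untwist: "twist x (untwist x g) = g" and untwist_twist: "untwist x (twist x g) = g"
  using additive_ext[of "\<lambda>g. twist x (untwist x g)" "\<lambda>g. g"]
    additive_ext[of "\<lambda>g. untwist x (twist x g)" "\<lambda>g. g"]
    additive_comp[OF additive_twist additive_untwist] additive_comp[OF additive_untwist additive_twist]
  by (cases x; simp add: additive_def)+

text \<open>\<open>True\<close> keeps a generator and \<open>False\<close> inverts it, so composing
  flips compares the flags by equality.\<close>

definition flip :: "bool \<Rightarrow> bool \<Rightarrow> free2 \<Rightarrow> free2" where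
  "flip s t = sub (if s then genA else - genA) (if t then genB else - genB)"

lemma additive_flip: "additive (flip s t)"
  by (simp add: flip_def additive_sub)

lemma flip_simps [simp]:
  "flip s t genA = (if s then genA else - genA)" "flip s t genB = (if t then genB else - genB)"
  "flip s t (g + h) = flip s t g + flip s t h" "flip s t (- g) = - flip s t g"
  "flip s t (g - h) = flip s t g - flip s t h" "flip s t 0 = 0"
  using additive_flip[of s t] additive_zero by (auto simp: flip_def)

lemma flip_flip: "flip s t (flip s' t' g) = flip (s = s') (t = t') g"
  by (rule additive_ext[of "\<lambda>g. flip s t (flip s' t' g)"])
     (auto simp: additive_comp additive_flip)

lemma flip_id [simp]: "flip True True g = g"
  by (rule additive_ext[of "flip True True" "\<lambda>g. g"])
     (simp_all add: additive_flip, simp add: additive_def)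

definition flip_letter :: "bool \<Rightarrow> bool \<Rightarrow> letter \<Rightarrow> letter" where
  "flip_letter s t l = (fst l, snd l = (case fst l of GenA \<Rightarrow> s | GenB \<Rightarrow> t))"

lemma flip_grp: "flip s t (grp w) = grp (map (flip_letter s t) w)"
proof (induction w)
  case (Cons l w)
  have "flip s t (grp [l]) = grp [flip_letter s t l]"
    by (cases l; cases "fst l"; cases "snd l"; cases s; cases t)
       (auto simp: flip_def sub_grp flip_letter_def grp_letter)
  then show ?case using Cons additive_flip[of s t] grp_Cons[of l w]
      grp_Cons[of "flip_letter s t l" "map (flip_letter s t) w"] by (simp add: additive_def)
qed (simp add: additive_zero[OF additive_flip])

lemma flip_letter_inv: "flip_letter s t (letter_inv l) = letter_inv (flip_letter s t l)"
  by (auto simp: flip_letter_def letter_inv_def)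

lemma flip_letter_inject: "flip_letter s t l = flip_letter s t l' \<longleftrightarrow> l = l'"
  by (cases l; cases l'; cases "fst l") (auto simp: flip_letter_def)

lemma reduced_flip: "reduced w \<Longrightarrow> reduced (map (flip_letter s t) w)"
  by (induction w) (auto simp: reduced_Cons hd_map flip_letter_inject simp flip: flip_letter_inv)

lemma cyclically_reduced_flip:
  "cyclically_reduced w \<Longrightarrow> cyclically_reduced (map (flip_letter s t) w)"
  by (auto simp: cyclically_reduced_def reduced_flip hd_map last_map flip_letter_inject
      simp flip: flip_letter_inv)

definition swap :: "free2 \<Rightarrow> free2" where "swap = sub genB genA"

lemma additive_swap: "additive swap"
  by (simp add: swap_def additive_sub)

lemma swap_simps [simp]:
  "swap genA = genB" "swap genB = genA" "swap (g + h) = swap g + swap h" "swap (- g) = - swap g"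
  "swap (g - h) = swap g - swap h"
  by (simp_all add: swap_def)

lemma swap_swap: "swap (swap g) = g"
  by (rule additive_ext[of "\<lambda>g. swap (swap g)" "\<lambda>g. g"])
     (simp_all add: additive_comp additive_swap, simp add: additive_def)

lemma swap_grp: "swap (grp w) = grp (map (\<lambda>l. (oth (fst l), snd l)) w)"
proof (induction w)
  case (Cons l w)
  have "swap (grp [l]) = grp [(oth (fst l), snd l)]"
    by (cases l; cases "fst l"; cases "snd l") (auto simp: swap_def sub_grp grp_letter)
  then show ?case using Cons additive_swap grp_Cons[of l w]
      grp_Cons[of "(oth (fst l), snd l)" "map (\<lambda>l. (oth (fst l), snd l)) w"]
    by (simp add: additive_def)
qed (simp add: additive_zero[OF additive_swap])

lemma one_signed_swap: "one_signed g \<Longrightarrow> one_signed (swap g)"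
proof -
  assume "one_signed g"
  then obtain v where v: "one_signed_word v" "g \<sim> grp v" by (auto simp: one_signed_def)
  have "one_signed_word (map (\<lambda>l. (oth (fst l), snd l)) v)"
    using v(1) by (auto simp: one_signed_word_def)
  then show ?thesis
    using conj2_additive[OF additive_swap v(2)] unfolding swap_grp one_signed_def by blast
qed

lemma one_signed_neg: "one_signed g \<Longrightarrow> one_signed (flip False False g)"
proof -
  assume "one_signed g"
  then obtain v where v: "one_signed_word v" "g \<sim> grp v" by (auto simp: one_signed_def)
  obtain e where e: "\<forall>l\<in>set v. snd l = e" using v(1) by (auto simp: one_signed_word_def)
  have "snd (flip_letter False False l) = (\<not> snd l)" for l
    by (simp add: flip_letter_def split: gen.splits)
  then have "one_signed_word (map (flip_letter False False) v)"
    using e unfolding one_signed_word_def by (intro exI[of _ "\<not> e"]) simp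
  then show ?thesis
    using conj2_additive[OF additive_flip v(2)] unfolding flip_grp one_signed_def by blast
qed

text \<open>Twists send generators to positive words; negative words are handled through their
  inverses.\<close>

lemma one_signed_twist:
  assumes "one_signed g"
  shows "one_signed (twist x g)"
proof -
  have pos: "\<exists>w. (\<forall>l\<in>set w. snd l) \<and> twist x (grp v) = grp w" if "\<forall>l\<in>set v. snd l" for v
    using that
  proof (induction v)
    case Nil
    show ?case by (intro exI[of _ "[]"]) simp
  next
    case (Cons l v)
    then obtain w where w: "\<forall>l\<in>set w. snd l" "twist x (grp v) = grp w" by auto
    obtain y where l: "l = (y, True)" using Cons.prems by (cases l) auto
    have "\<exists>u. (\<forall>l\<in>set u. snd l) \<and> twist x (grp [l]) = grp u"
    proof (cases "y = x")
      case True
      then show ?thesis using l grp_append[of "[(x, True)]" "[(oth x, True)]"]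
        by (intro exI[of _ "[(x, True), (oth x, True)]"]) (simp flip: gl_def)
    next
      case False
      then show ?thesis using l by (intro exI[of _ "[l]"]) (simp add: neq_oth flip: gl_def)
    qed
    then obtain u where "\<forall>l\<in>set u. snd l" "twist x (grp [l]) = grp u" by blast
    then show ?case using w grp_Cons[of l v] by (intro exI[of _ "u @ w"]) (auto simp: grp_append)
  qed
  obtain v e where v: "\<forall>l\<in>set v. snd l = e" "g \<sim> grp v"
    using assms by (auto simp: one_signed_def one_signed_word_def)
  have "\<exists>w. one_signed_word w \<and> twist x (grp v) = grp w"
  proof (cases e)
    case True
    then show ?thesis using pos[of v] v(1) by (auto simp: one_signed_word_def)
  next
    case False
    then have "\<forall>l\<in>set (word_inv v). snd l" using v(1) by (auto simp: letter_inv_def)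
    then obtain w where w: "\<forall>l\<in>set w. snd l" "twist x (grp (word_inv v)) = grp w"
      using pos by blast
    then have "twist x (grp v) = grp (word_inv w)"
      by (simp only: grp_word_inv twist_uminus) (metis add.inverse_inverse)
    moreover have "one_signed_word (word_inv w)"
      using w(1) unfolding one_signed_word_def by (intro exI[of _ False]) (auto simp: letter_inv_def)
    ultimately show ?thesis by blast
  qed
  then show ?thesis
    using conj2_additive[OF additive_twist v(2), of x] unfolding one_signed_def by metis
qed

section \<open>Removing mixed signs from chains\<close>

definition tamable :: "free2 \<Rightarrow> bool" where
  "tamable g \<longleftrightarrow> (\<exists>xs. one_signed (twists xs g))"

lemma tamable_conj: "g \<sim> h \<Longrightarrow> tamable g \<longleftrightarrow> tamable h"
  unfolding tamable_def using one_signed_conj twists_conj by blast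

lemma tamable_twist: "tamable (twist x g) \<Longrightarrow> tamable g"
  unfolding tamable_def by (metis twists.simps(2))

lemma twists_swap: "twists xs (swap g) = swap (twists (map oth xs) g)"
proof (induction xs arbitrary: g)
  case (Cons x xs)
  have "twist x (swap g) = swap (twist (oth x) g)" for g
    by (rule additive_ext[of "\<lambda>g. twist x (swap g)" "\<lambda>g. swap (twist (oth x) g)"])
       (simp_all add: additive_comp additive_twist additive_swap, (cases x; simp)+)
  then show ?case using Cons by simp
qed simp

lemma tamable_swap: "tamable (swap g) \<Longrightarrow> tamable g"
  unfolding tamable_def by (metis one_signed_swap swap_swap twists_swap)

lemma conj2_ext:
  assumes "additive f" "additive h"
    and "h genA = c + f genA - c" "h genB = c + f genB - c"
  shows "f g \<sim> h g"
  unfolding conj2_def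
  by (rule exI[of _ c], rule additive_ext[OF assms(2) additive_conj[OF assms(1)] assms(3,4)])

lemma twists_conj_commute:
  assumes "additive f" "\<And>x g. f (twist x g) \<sim> twist x (f g)"
  shows "f (twists xs g) \<sim> twists xs (f g)"
proof (induction xs arbitrary: g)
  case (Cons x xs)
  then show ?case using twists_conj[OF assms(2)] conj2_trans by simp blast
qed simp

text \<open>Inverting a product reverses its two letters, while inverting both generators does not;
  conjugation by the added letter accounts for the difference.\<close>

lemma neg_twist: "flip False False (twist x g) \<sim> twist x (flip False False g)"
proof (rule conj2_ext[of "\<lambda>g. flip False False (twist x g)" "\<lambda>g. twist x (flip False False g)"
      "case x of GenA \<Rightarrow> - genB | GenB \<Rightarrow> - genA"])
  show "additive (\<lambda>g. flip False False (twist x g))" "additive (\<lambda>g. twist x (flip False False g))"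
    by (simp_all add: additive_comp additive_twist additive_flip)
qed (cases x; simp add: group_add_norm del: add_uminus_conv_diff)+

lemma tamable_neg: "tamable (flip False False g) \<Longrightarrow> tamable g"
proof -
  assume "tamable (flip False False g)"
  then obtain xs where "one_signed (twists xs (flip False False g))" by (auto simp: tamable_def)
  then have "one_signed (flip False False (twists xs g))"
    using twists_conj_commute[OF additive_flip neg_twist] one_signed_conj by blast
  then have "one_signed (twists xs g)" using one_signed_neg by (fastforce simp: flip_flip)
  then show ?thesis by (auto simp: tamable_def)
qed

abbreviation iota :: "free2 \<Rightarrow> free2" where "iota \<equiv> flip True False"

lemma iota_iota [simp]: "iota (iota g) = g"
  by (simp add: flip_flip)

text \<open>This exchanges the two types of chains up to conjugation.\<close>

lemma iota_untwist: "iota (untwist x g) \<sim> twist x (iota g)"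
proof (rule conj2_ext[of "\<lambda>g. iota (untwist x g)" "\<lambda>g. twist x (iota g)"
      "case x of GenA \<Rightarrow> 0 | GenB \<Rightarrow> - genA"])
  show "additive (\<lambda>g. iota (untwist x g))" "additive (\<lambda>g. twist x (iota g))"
    by (simp_all add: additive_comp additive_twist additive_untwist additive_flip)
qed (cases x; simp add: group_add_norm del: add_uminus_conv_diff)+

text \<open>A twist after an inverse twist of the other kind is a single twist, up to signed
  permutations on both sides and, in the second case, conjugation.\<close>

lemma twist_untwist_oth:
  "twist GenB (untwist GenA g) = flip False False (swap (twist GenB (iota g)))"
  "swap (twist GenA (iota g)) \<sim> twist GenA (untwist GenB g)"
proof -
  show "twist GenB (untwist GenA g) = flip False False (swap (twist GenB (iota g)))"
  proof (rule additive_ext[of "\<lambda>g. twist GenB (untwist GenA g)"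
        "\<lambda>g. flip False False (swap (twist GenB (iota g)))"])
    show "additive (\<lambda>g. twist GenB (untwist GenA g))"
      "additive (\<lambda>g. flip False False (swap (twist GenB (iota g))))"
      by (rule additive_comp[OF additive_twist additive_untwist])
        (rule additive_comp[OF additive_flip additive_comp[OF additive_swap
          additive_comp[OF additive_twist additive_flip]]])
  qed (simp_all add: group_add_norm del: add_uminus_conv_diff)
  show "swap (twist GenA (iota g)) \<sim> twist GenA (untwist GenB g)"
  proof (rule conj2_ext[of "\<lambda>g. swap (twist GenA (iota g))" "\<lambda>g. twist GenA (untwist GenB g)" genA])
    show "additive (\<lambda>g. swap (twist GenA (iota g)))" "additive (\<lambda>g. twist GenA (untwist GenB g))"
      by (rule additive_comp[OF additive_swap additive_comp[OF additive_twist additive_flip]])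
        (rule additive_comp[OF additive_twist additive_untwist])
  qed (simp_all add: group_add_norm del: add_uminus_conv_diff)
qed

text \<open>The first twist of the chain either cancels the inverse twist or merges with it into one
  twist of \<open>iota g\<close>. If the chain is empty, applying \<open>twist x\<close> recovers
  \<open>g\<close> and preserves one-signedness.\<close>

lemma tamable_untwist:
  assumes "tamable (untwist x g)"
  shows "tamable g \<or> tamable (iota g)"
proof -
  obtain xs where xs: "one_signed (twists xs (untwist x g))"
    using assms by (auto simp: tamable_def)
  show ?thesis
  proof (cases xs)
    case Nil
    then have "one_signed (twist x (untwist x g))" using xs one_signed_twist by simp
    then have "one_signed (twists [] g)" by (simp add: twist_untwist)
    then show ?thesis unfolding tamable_def by blast
  next
    case (Cons y ys)
    then have *: "tamable (twist y (untwist x g))" using xs by (auto simp: tamable_def)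
    consider "y = x" | "x = GenA" "y = GenB" | "x = GenB" "y = GenA"
      by (cases x; cases y) auto
    then show ?thesis
    proof cases
      case 1
      then show ?thesis using * by (simp add: twist_untwist)
    next
      case 2
      then have "tamable (flip False False (swap (twist GenB (iota g))))"
        using * unfolding twist_untwist_oth(1)[symmetric] by simp
      then have "tamable (twist GenB (iota g))" using tamable_neg tamable_swap by blast
      then show ?thesis using tamable_twist by blast
    next
      case 3
      then have "tamable (swap (twist GenA (iota g)))"
        using * tamable_conj[OF twist_untwist_oth(2)] by simp
      then show ?thesis using tamable_swap tamable_twist by blast
    qed
  qed
qed

text \<open>Admitting \<open>iota\<close> covers both types of chains and makes the property stable
  under the automorphisms that the Nielsen moves induce.\<close>

definition bitamable :: "free2 \<Rightarrow> bool" where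
  "bitamable g \<longleftrightarrow> tamable g \<or> tamable (iota g)"

lemma bitamable_iota: "bitamable (iota g) \<longleftrightarrow> bitamable g"
  by (auto simp: bitamable_def)

lemma bitamable_untwist: "bitamable (untwist x g) \<Longrightarrow> bitamable g"
  unfolding bitamable_def using tamable_untwist tamable_conj[OF iota_untwist] tamable_twist by blast

lemma bitamable_swap: "bitamable (swap g) \<Longrightarrow> bitamable g"
proof -
  have "iota (swap g) = flip False False (swap (iota g))"
    by (rule additive_ext[of "\<lambda>g. iota (swap g)" "\<lambda>g. flip False False (swap (iota g))",
          OF additive_comp[OF additive_flip additive_swap]
            additive_comp[OF additive_flip additive_comp[OF additive_swap additive_flip]]])
      simp_all
  then show "bitamable (swap g) \<Longrightarrow> bitamable g"
    unfolding bitamable_def using tamable_swap tamable_neg by metis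
qed

lemma bitamable_neg: "bitamable (flip False False g) \<Longrightarrow> bitamable g"
  unfolding bitamable_def using tamable_neg[of g] tamable_neg[of "iota g"] by (auto simp: flip_flip)

text \<open>The implication is carried back from the last pair to the first: each elementary move
  rewrites the old substitution as the new one after a signed permutation or \<open>untwist\<close>,
  and a conjugation only conjugates the values.\<close>

lemma nielsen_bitamable:
  assumes "nielsen x y p q"
    and "\<And>u. one_signed (sub p q u) \<Longrightarrow> bitamable u"
    and "one_signed (sub x y u)"
  shows "bitamable u"
  using assms
proof (induction arbitrary: u)
  case (swap p q)
  have "sub p q u = sub q p (swap u)" for u
    by (rule additive_ext[of _ "\<lambda>u. sub q p (swap u)"])
       (simp_all add: additive_comp additive_sub additive_swap)
  then show ?case using swap bitamable_swap by metis
next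
  case (neg p q)
  have "sub p q u = sub (- p) q (flip False True u)" for u
    by (rule additive_ext[of _ "\<lambda>u. sub (- p) q (flip False True u)"])
       (simp_all add: additive_comp additive_sub additive_flip)
  moreover have "bitamable (flip False True u) \<Longrightarrow> bitamable u" for u
    using bitamable_neg[of "iota u"] by (simp add: flip_flip bitamable_iota)
  ultimately show ?case using neg by metis
next
  case (add p q)
  have "sub p q u = sub (p + q) q (untwist GenA u)" for u
    by (rule additive_ext[of _ "\<lambda>u. sub (p + q) q (untwist GenA u)"])
       (simp_all add: additive_comp additive_sub additive_untwist del: untwist.simps, simp_all)
  then show ?case using add bitamable_untwist by metis
next
  case (conj p q c)
  have "sub p q u \<sim> sub (c + p - c) (c + q - c) u" for u
    by (rule conj2_ext[of "sub p q" "sub (c + p - c) (c + q - c)" c]) (simp_all add: additive_sub)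
  then show ?case using conj one_signed_conj by metis
qed

theorem bitamable_if_one_signed:
  assumes "surj (sub x y)" "one_signed (sub x y u)"
  shows "bitamable u"
proof (rule nielsen_bitamable[OF nielsen_generators[OF assms(1)] _ assms(2)])
  fix v
  assume *: "one_signed (sub genA genB v)"
  \<comment> \<open>The final pair of the Nielsen reduction gives the identity, for which the empty
    chain suffices.\<close>
  have "sub genA genB v = v"
    by (rule additive_ext[of _ "\<lambda>v. v"]) (simp_all add: additive_sub, simp add: additive_def)
  then have "one_signed (twists [] v)" using * by simp
  then show "bitamable v" unfolding bitamable_def tamable_def by blast
qed

fun untwists :: "gen list \<Rightarrow> free2 \<Rightarrow> free2" where
  "untwists [] g = g"
| "untwists (x # xs) g = untwists xs (untwist x g)"

lemma iota_untwists: "iota (untwists xs g) \<sim> twists xs (iota g)"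
proof (induction xs arbitrary: g)
  case (Cons x xs)
  then show ?case using twists_conj[OF iota_untwist] conj2_trans by simp blast
qed simp

theorem short_chain:
  assumes "bitamable g" "cyclically_reduced w" "g \<sim> grp w"
  obtains xs where "length xs \<le> length w" "one_signed (twists xs g)"
  | xs where "length xs \<le> length w" "one_signed (iota (untwists xs g))"
proof -
  consider xs where "one_signed (twists xs g)" | xs where "one_signed (twists xs (iota g))"
    using assms(1) by (auto simp: bitamable_def tamable_def)
  then show ?thesis
  proof cases
    case 1
    then show ?thesis using shorten_twists[OF assms(2,3)] that by metis
  next
    case 2
    \<comment> \<open>The flipped word has the same length, so the bound survives;
      \<open>iota_untwists\<close> then turns the twists into inverse twists.\<close>
    have "iota g \<sim> grp (map (flip_letter True False) w)"
      using conj2_additive[OF additive_flip assms(3)] by (simp add: flip_grp)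
    from shorten_twists[OF cyclically_reduced_flip[OF assms(2)] this 2]
    obtain zs where "length zs \<le> length w" "one_signed (twists zs (iota g))" by auto
    then show ?thesis using that one_signed_conj[OF iota_untwists] by blast
  qed
qed

section \<open>Transfer to the group F2\<close>

lemma F2_simps [simp]:
  "carrier F2 = {w. reduced w}" "mult F2 v w = reduce (v @ w)" "one F2 = []"
  by (simp_all add: F2_def)

lemma group_F2: "group F2"
proof (rule groupI)
  fix x assume "x \<in> carrier F2"
  then show "\<exists>y\<in>carrier F2. y \<otimes>\<^bsub>F2\<^esub> x = \<one>\<^bsub>F2\<^esub>"
    by (intro bexI[of _ "word_inv x"]) (simp_all add: reduce_word_inv_append)
qed (auto simp: reduce_append_reduce reduce_id)

lemma inv_F2: "reduced w \<Longrightarrow> inv\<^bsub>F2\<^esub> w = word_inv w"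
  using group.inv_equality[OF group_F2, of "word_inv w" w] by (simp add: reduce_word_inv_append)

lemma nf_add: "nf (g + h) = reduce (nf g @ nf h)"
  by (simp add: plus_free2_def)

lemma nf_grp_reduced: "reduced w \<Longrightarrow> nf (grp w) = w"
  by (simp add: reduce_id)

lemma inner_eq:
  assumes "reduced c" "reduced v"
  shows "inner c v = nf (grp c + grp v - grp c)"
  using assms
  by (simp add: inner_def inv_F2 nf_add diff_conv_add_uminus nf_uminus reduce_id reduce_append_reduce
      del: add_uminus_conv_diff)

lemma letter_image_eq:
  assumes "reduced x" "reduced y"
  shows "letter_image x y l = nf (limg (grp x) (grp y) l)"
  using assms by (cases l; cases "fst l")
    (auto simp: letter_image_def limg_def inv_F2 nf_uminus reduce_id Let_def)

lemma F2_endo_eq: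
  assumes "reduced x" "reduced y"
  shows "F2_endo x y w = nf (sub (grp x) (grp y) (grp w))"
proof -
  have "F2_endo x y w = nf (limgs (grp x) (grp y) w)"
    by (induction w) (simp_all add: F2_endo_def letter_image_eq[OF assms] nf_add)
  then show ?thesis by (simp add: sub_grp)
qed

lemma grp_gens: "grp gen_a = genA" "grp gen_b = genB" "reduced gen_a" "reduced gen_b"
  by (simp_all add: gen_a_def gen_b_def genA_def genB_def)

lemma sigma_eq: "sigma w = nf (twist GenA (grp w))"
  by (simp add: sigma_def F2_endo_eq grp_gens grp_append)

lemma tau_eq: "tau w = nf (twist GenB (grp w))"
  by (simp add: tau_def F2_endo_eq grp_gens grp_append)

lemma inv_into_twist:
  assumes "\<And>w. f w = nf (twist x (grp w))" "reduced w"
  shows "inv_into (carrier F2) f w = nf (untwist x (grp w))"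
proof (rule inv_into_f_eq)
  show "inj_on f (carrier F2)"
  proof (rule inj_onI)
    fix v w assume vw: "v \<in> carrier F2" "w \<in> carrier F2" "f v = f w"
    then have "untwist x (twist x (grp v)) = untwist x (twist x (grp w))"
      using assms(1) by (metis grp_nf)
    then have "grp v = grp w" unfolding untwist_twist .
    then show "v = w" using vw(1,2) by (simp add: grp_eq_iff reduce_id)
  qed
  show "nf (untwist x (grp w)) \<in> carrier F2" by simp
  show "f (nf (untwist x (grp w))) = w"
    using assms(2) by (simp add: assms(1) twist_untwist reduce_id)
qed

lemma sigma_inv_eq: "reduced w \<Longrightarrow> sigma_inv w = nf (untwist GenA (grp w))"
  unfolding sigma_inv_def by (rule inv_into_twist[OF sigma_eq])

lemma tau_inv_eq: "reduced w \<Longrightarrow> tau_inv w = nf (untwist GenB (grp w))"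
  unfolding tau_inv_def by (rule inv_into_twist[OF tau_eq])

text \<open>One pair per twist, with the other exponent zero, so that the length of the chain is the
  number of twists.\<close>

definition exponents :: "gen list \<Rightarrow> (nat \<times> nat) list" where
  "exponents xs = map (case_gen (1, 0) (0, 1)) xs"

lemma chain_length_exponents: "chain_length (exponents xs) = length xs"
  by (induction xs) (auto simp: chain_length_def exponents_def split: gen.splits)

lemma chain_exponents: "chain s t (exponents xs) w = fold (case_gen s t) xs w"
proof -
  \<comment> \<open>The induction needs an arbitrary accumulated composition \<open>f\<close> in
    place of \<open>id\<close>.\<close>
  have "fold (\<lambda>(l, m) f. (t ^^ m) \<circ> (s ^^ l) \<circ> f) (exponents xs) f w = fold (case_gen s t) xs (f w)" for f
    by (induction xs arbitrary: f) (auto simp: exponents_def split: gen.splits)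
  then show ?thesis by (simp add: chain_def)
qed

lemma fold_twist:
  "reduced w \<Longrightarrow> fold (case_gen sigma tau) xs w = nf (twists xs (grp w))"
  "reduced w \<Longrightarrow> fold (case_gen sigma_inv tau_inv) xs w = nf (untwists xs (grp w))"
  by (induction xs arbitrary: w)
     (auto simp: reduce_id sigma_eq tau_eq sigma_inv_eq tau_inv_eq simp del: twist.simps untwist.simps
       split: gen.splits)

lemma reduced_chain:
  assumes "\<And>w. reduced w \<Longrightarrow> reduced (s w)" "\<And>w. reduced w \<Longrightarrow> reduced (t w)" "reduced w"
  shows "reduced (chain s t es w)"
proof -
  have pow: "reduced w \<Longrightarrow> reduced ((f ^^ n) w)" if "\<And>w. reduced w \<Longrightarrow> reduced (f w)" for f n w
    using that by (induction n) auto
  have "reduced (fold (\<lambda>(l, m) f. (t ^^ m) \<circ> (s ^^ l) \<circ> f) es f w)" if "reduced (f w)" for f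
    using that
  proof (induction es arbitrary: f)
    case (Cons e es)
    then show ?case using pow[OF assms(1)] pow[OF assms(2)] by (cases e) auto
  qed simp
  then show ?thesis using assms(3) by (simp add: chain_def)
qed

lemma reduced_Omega:
  assumes "\<psi> \<in> Omega u" "reduced w"
  shows "reduced (\<psi> w)"
  using assms unfolding Omega_def C1_chains_def C2_chains_def
  by (auto intro!: reduced_chain simp: sigma_eq tau_eq sigma_inv_eq tau_inv_eq)

section \<open>Cyclic words as conjugacy classes\<close>

lemma inner_conj2:
  assumes "reduced v" "reduced w"
  shows "(\<exists>c\<in>carrier F2. w = inner c v) \<longleftrightarrow> grp v \<sim> grp w"
proof
  assume "\<exists>c\<in>carrier F2. w = inner c v"
  then show "grp v \<sim> grp w" using assms by (auto simp: inner_eq conj2_def)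
next
  assume "grp v \<sim> grp w"
  then obtain c where "grp w = grp (nf c) + grp v - grp (nf c)" by (auto simp: conj2_def)
  then have "w = inner (nf c) v" using assms by (metis inner_eq nf_grp_reduced reduced_nf)
  then show "\<exists>c\<in>carrier F2. w = inner c v" by (intro bexI[of _ "nf c"]) simp_all
qed

lemma cyclic_word_eq:
  assumes "reduced v"
  shows "cyclic_word v = {w. cyclically_reduced w \<and> grp v \<sim> grp w}"
proof -
  have "cyclically_reduced w \<and> (\<exists>c\<in>carrier F2. w = inner c v) \<longleftrightarrow>
    cyclically_reduced w \<and> grp v \<sim> grp w" for w
    unfolding cyclically_reduced_def using inner_conj2[OF assms, of w] by blast
  then have "cyclic_word v = {rotate n w | n w. cyclically_reduced w \<and> grp v \<sim> grp w}"
    unfolding cyclic_word_def by simp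
  also have "\<dots> = {w. cyclically_reduced w \<and> grp v \<sim> grp w}"
  proof (intro equalityI subsetI)
    fix w assume "w \<in> {w. cyclically_reduced w \<and> grp v \<sim> grp w}"
    then show "w \<in> {rotate n w | n w. cyclically_reduced w \<and> grp v \<sim> grp w}"
      by (auto intro!: exI[of _ 0])
  qed (use cyclically_reduced_rotate conj2_rotate conj2_trans in blast)
  finally show ?thesis .
qed

lemma positive_one_signed: "positive w \<Longrightarrow> one_signed_word w"
  by (auto simp: positive_def one_signed_word_def)

text \<open>One direction uses that a cyclically reduced conjugate exists. For the other, a positive
  word is cyclically reduced, so every cyclically reduced conjugate is a rotation of it.\<close>

lemma positive_cyclic_iff:
  assumes "reduced v"
  shows "positive_cyclic (cyclic_word v) \<longleftrightarrow> (\<exists>w. positive w \<and> grp v \<sim> grp w)"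
proof
  assume "positive_cyclic (cyclic_word v)"
  moreover obtain w where "cyclically_reduced w" "grp v \<sim> grp w"
    using ex_cyclically_reduced by blast
  ultimately show "\<exists>w. positive w \<and> grp v \<sim> grp w"
    by (auto simp: cyclic_word_eq[OF assms] positive_cyclic_def)
next
  assume "\<exists>w. positive w \<and> grp v \<sim> grp w"
  then obtain p where p: "positive p" "grp v \<sim> grp p" by blast
  have "positive w" if w: "cyclically_reduced w" "grp v \<sim> grp w" for w
  proof -
    have "grp p \<sim> grp w" by (rule conj2_trans[OF conj2_sym[OF p(2)] w(2)])
    then obtain n where "w = rotate n p"
      using cyclically_reduced_conjugate[OF cyclically_reduced_one_signed[OF positive_one_signed[OF p(1)]]
          w(1)] by blast
    then show ?thesis using p by (simp add: positive_def)
  qed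
  then show "positive_cyclic (cyclic_word v)"
    by (auto simp: cyclic_word_eq[OF assms] positive_cyclic_def)
qed

lemma positive_cyclic_iff_inner:
  assumes "reduced v"
  shows "positive_cyclic (cyclic_word v) \<longleftrightarrow> (\<exists>c\<in>carrier F2. positive (inner c v))"
proof -
  have "(\<exists>w. positive w \<and> grp v \<sim> grp w) \<longleftrightarrow> (\<exists>w. positive w \<and> reduced w \<and> grp v \<sim> grp w)"
    using cyclically_reduced_one_signed positive_one_signed cyclically_reduced_def by blast
  also have "\<dots> \<longleftrightarrow> (\<exists>c\<in>carrier F2. positive (inner c v))"
    using inner_conj2[OF assms] inner_eq[OF _ assms] reduced_nf by (metis F2_simps(1) mem_Collect_eq)
  finally show ?thesis using positive_cyclic_iff[OF assms] by simp
qed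

lemma cyclic_length_witness:
  assumes "reduced u"
  obtains w where "cyclically_reduced w" "grp u \<sim> grp w" "length w = cyclic_length u"
proof -
  have "(SOME w. w \<in> cyclic_word u) \<in> cyclic_word u"
    by (rule someI_ex) (use ex_cyclically_reduced[of "grp u"] in \<open>simp add: cyclic_word_eq[OF assms]\<close>)
  then show ?thesis
    using that[of "SOME w. w \<in> cyclic_word u"] unfolding cyclic_length_def
    by (simp add: cyclic_word_eq[OF assms])
qed

section \<open>Sign changes as Whitehead automorphisms of type (W1)\<close>

definition flip_word :: "bool \<Rightarrow> bool \<Rightarrow> word \<Rightarrow> word" where
  "flip_word s t w = nf (flip s t (grp w))"

lemma flip_word_Whitehead1: "flip_word s t \<in> Whitehead1"
proof -
  have inv: "flip_word s t (flip_word s t w) = w" if "reduced w" for w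
    using that by (simp add: flip_word_def flip_flip reduce_id)
  have "flip_word s t \<in> hom F2 F2"
    by (rule homI) (simp_all add: flip_word_def grp_append nf_add reduce_append_reduce)
  moreover have "bij_betw (flip_word s t) (carrier F2) (carrier F2)"
    by (rule bij_betw_byWitness[of _ "flip_word s t"]) (auto simp: inv, auto simp: flip_word_def)
  moreover have gens: "gen_a = nf genA" "gen_b = nf genB"
    using nf_grp_reduced grp_gens by metis+
  then have "inv\<^bsub>F2\<^esub> gen_a = nf (- genA)" "inv\<^bsub>F2\<^esub> gen_b = nf (- genB)"
    by (simp_all only: gens inv_F2[OF reduced_nf] nf_uminus)
  moreover have "flip_word s t (nf g) = nf (flip s t g)" for g
    by (simp add: flip_word_def)
  then have "flip_word s t ` {nf genA, nf genB, nf (- genA), nf (- genB)} =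
      {nf genA, nf genB, nf (- genA), nf (- genB)}"
    by (cases s; cases t) (simp_all add: insert_commute)
  ultimately show ?thesis
    unfolding Whitehead1_def iso_def by (simp add: gens)
qed

lemma positive_cyclic_flip_word:
  assumes "reduced v" "one_signed (flip s t (grp v))"
  shows "\<exists>\<beta>\<in>Whitehead1. positive_cyclic (cyclic_word (\<beta> v))"
proof -
  obtain w e where w: "\<forall>l\<in>set w. snd l = e" "flip s t (grp v) \<sim> grp w"
    using assms(2) by (auto simp: one_signed_def one_signed_word_def)
  \<comment> \<open>For \<open>e = True\<close> nothing changes, for \<open>e = False\<close> all
    signs are reversed; either way the combined sign change is a \<open>flip_word\<close>.\<close>
  define w' where "w' = map (flip_letter e e) w"
  have "flip e e (flip s t (grp v)) \<sim> grp w'"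
    using conj2_additive[OF additive_flip w(2)] unfolding w'_def flip_grp .
  then have "grp (flip_word (e = s) (e = t) v) \<sim> grp w'"
    by (simp only: flip_word_def grp_nf flip_flip)
  moreover have "positive w'"
    using w(1) by (auto simp: w'_def positive_def flip_letter_def split: gen.splits)
  moreover have "reduced (flip_word (e = s) (e = t) v)" by (simp add: flip_word_def)
  ultimately show ?thesis using positive_cyclic_iff flip_word_Whitehead1 by blast
qed

lemma iso_F2_surj_sub:
  assumes "\<phi> \<in> iso F2 F2"
  obtains x y where "surj (sub x y)" "\<And>w. reduced w \<Longrightarrow> grp (\<phi> w) = sub x y (grp w)"
proof -
  define f where "f g = grp (\<phi> (nf g))" for g
  have hom: "\<phi> \<in> hom F2 F2" and bij: "bij_betw \<phi> (carrier F2) (carrier F2)"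
    using assms by (auto simp: iso_def)
  have "additive f"
    unfolding additive_def f_def using hom_mult[OF hom] by (simp add: nf_add grp_append)
  then have f: "f g = sub (f genA) (f genB) g" for g by (rule additive_eq_sub)
  have "\<exists>g. h = f g" for h
  proof -
    have "nf h \<in> \<phi> ` carrier F2" using bij by (simp add: bij_betw_def)
    then obtain w where "reduced w" "nf h = \<phi> w" by auto
    then show ?thesis by (intro exI[of _ "grp w"]) (simp add: f_def reduce_id flip: \<open>nf h = _\<close>)
  qed
  then have "surj (sub (f genA) (f genB))" unfolding surj_def using f by metis
  then show ?thesis using that f by (metis f_def nf_grp_reduced)
qed

theorem theorem2p2:
  fixes u :: word and \<phi> :: "word \<Rightarrow> word"
  assumes "u \<in> carrier F2"
    and "\<phi> \<in> iso F2 F2"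
    and "positive_cyclic (cyclic_word (\<phi> u))"
  shows "(\<exists>\<psi>\<in>Omega u. \<exists>\<beta>\<in>Whitehead1. positive_cyclic (cyclic_word (\<beta> (\<psi> u)))) \<and>
    (\<forall>\<psi>\<in>Omega u. \<forall>\<beta>\<in>Whitehead1.
       positive_cyclic (cyclic_word (\<beta> (\<psi> u))) \<longleftrightarrow>
       (\<exists>c\<in>carrier F2. positive (inner c (\<beta> (\<psi> u)))))"
proof
  have u: "reduced u" using assms(1) by simp
  have "reduced (\<phi> u)" using assms(1,2) hom_in_carrier[of \<phi> F2 F2 u] by (auto simp: iso_def)
  from positive_cyclic_iff[OF this] have "one_signed (grp (\<phi> u))"
    using assms(3) positive_one_signed unfolding one_signed_def by blast
  moreover obtain x y where "surj (sub x y)" "grp (\<phi> u) = sub x y (grp u)"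
    using iso_F2_surj_sub[OF assms(2)] u by metis
  ultimately have "bitamable (grp u)" using bitamable_if_one_signed by simp
  moreover obtain w where w: "cyclically_reduced w" "grp u \<sim> grp w" "length w = cyclic_length u"
    using cyclic_length_witness[OF u] .
  \<comment> \<open>At most \<open>cyclic_length u\<close> twists are used, well within the bound in
    \<open>Omega\<close>.\<close>
  ultimately consider
    xs where "length xs \<le> cyclic_length u" "one_signed (twists xs (grp u))"
  | xs where "length xs \<le> cyclic_length u" "one_signed (iota (untwists xs (grp u)))"
    using short_chain by metis
  then show "\<exists>\<psi>\<in>Omega u. \<exists>\<beta>\<in>Whitehead1. positive_cyclic (cyclic_word (\<beta> (\<psi> u)))"
  proof cases
    case 1
    let ?\<psi> = "chain sigma tau (exponents xs)"
    have "?\<psi> \<in> Omega u"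
      using 1(1) by (auto simp: Omega_def C1_chains_def chain_length_exponents intro!: exI[of _ "exponents xs"])
    moreover have "?\<psi> u = nf (twists xs (grp u))"
      by (simp only: chain_exponents fold_twist(1)[OF u])
    then have "\<exists>\<beta>\<in>Whitehead1. positive_cyclic (cyclic_word (\<beta> (?\<psi> u)))"
      \<comment> \<open>The flags \<open>True True\<close> give the identity; for inverse chains
        below, \<open>True False\<close> is \<open>iota\<close>.\<close>
      using 1(2) by (intro positive_cyclic_flip_word[of _ True True]) simp_all
    ultimately show ?thesis by blast
  next
    case 2
    let ?\<psi> = "chain sigma_inv tau_inv (exponents xs)"
    have "?\<psi> \<in> Omega u"
      using 2(1) by (auto simp: Omega_def C2_chains_def chain_length_exponents intro!: exI[of _ "exponents xs"])
    moreover have "?\<psi> u = nf (untwists xs (grp u))"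
      by (simp only: chain_exponents fold_twist(2)[OF u])
    then have "\<exists>\<beta>\<in>Whitehead1. positive_cyclic (cyclic_word (\<beta> (?\<psi> u)))"
      using 2(2) by (intro positive_cyclic_flip_word[of _ True False]) simp_all
    ultimately show ?thesis by blast
  qed
  show "\<forall>\<psi>\<in>Omega u. \<forall>\<beta>\<in>Whitehead1.
      positive_cyclic (cyclic_word (\<beta> (\<psi> u))) \<longleftrightarrow>
      (\<exists>c\<in>carrier F2. positive (inner c (\<beta> (\<psi> u))))"
  proof (intro ballI positive_cyclic_iff_inner)
    fix \<psi> \<beta> assume "\<psi> \<in> Omega u" "\<beta> \<in> Whitehead1"
    then show "reduced (\<beta> (\<psi> u))"
      using reduced_Omega[OF _ u] hom_in_carrier[of \<beta> F2 F2 "\<psi> u"] by (auto simp: Whitehead1_def iso_def)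
  qed
qed

end
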